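(* Let $E\subset\mathbb{R}^n$ be a non-empty bounded set and let $m$ be an integer with $1\le m\le n$. If $\overline{\dim}_B E=\overline{\dim}_{qH}E$, then for $\gamma_{n,m}$-almost every $V\in G(n,m)$, $$\overline{\dim}_B(P_VE)=\min\{m,\overline{\dim}_BE\}.$$ Similarly, if $\underline{\dim}_B E=\underline{\dim}_{qH}E$, then for $\gamma_{n,m}$-almost every $V\in G(n,m)$, $$\underline{\dim}_B(P_VE)=\min\{m,\underline{\dim}_BE\}.$$
   Context: $\underline{\dim}_B$ and $\overline{\dim}_B$ denote the lower and upper box dimensions. $G(n,m)$ is the Grassmannian of all $m$-dimensional linear subspaces of $\mathbb{R}^n$, $\gamma_{n,m}$ is the Haar (rotation-invariant probability) measure on $G(n,m)$, and $P_V$ is the orthogonal projection of $\mathbb{R}^n$ onto $V$. $|U|$ denotes the diameter of a set $U$. Intermediate dimensions. For a non-empty bounded set $F\subset\mathbb{R}^n$ and $\theta\in(0,1]$, the lower $\theta$-intermediate dimension $\underline{\dim}_\theta F$ is the infimum of all $s\ge 0$ such that for all $\epsilon>0$ and all $\delta_0>0$ there exist $0<\delta\le\delta_0$ and a cover $\{U_i\}_{i\in I}$ of $F$ with $\delta^{1/\theta}\le|U_i|\le\delta$ for all $i$ and $\sum_{i}|U_i|^s\le\epsilon$. The upper $\theta$-intermediate dimension $\overline{\dim}_\theta F$ is the infimum of all $s\ge 0$ such that for all $\epsilon>0$ there exists $\delta_0>0$ such that for all $0<\delta\le\delta_0$ there is a cover $\{U_i\}_{i\in I}$ of $F$ with $\delta^{1/\theta}\le|U_i|\le\delta$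 for all $i$ and $\sum_i|U_i|^s\le\epsilon$. Quasi-Hausdorff dimensions. $\underline{\dim}_{qH}F:=\lim_{\theta\to0^+}\underline{\dim}_\theta F$ and $\overline{\dim}_{qH}F:=\lim_{\theta\to0^+}\overline{\dim}_\theta F$. *)

theory Defs
  imports "HOL-Probability.Probability"
begin

section \<open>Box dimensions\<close>

text \<open>
  The smallest number of sets of diameter at most \<open>\<delta>\<close> that cover \<open>F\<close>.  Boundedness
  of the covering sets is required explicitly because \<^const>\<open>diameter\<close> is a real
  supremum, hence meaningless on unbounded sets.
\<close>
definition covering_number :: "'a::metric_space set \<Rightarrow> real \<Rightarrow> nat" where
  "covering_number F \<delta> =
     (LEAST k. \<exists>\<C>. finite \<C> \<and> card \<C> = k \<and> F \<subseteq> \<Union>\<C> \<and>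
        (\<forall>U\<in>\<C>. bounded U \<and> diameter U \<le> \<delta>))"

definition lower_box_dim :: "'a::metric_space set \<Rightarrow> ereal" where
  "lower_box_dim F =
     Liminf (at_right 0) (\<lambda>\<delta>. ereal (ln (real (covering_number F \<delta>)) / - ln \<delta>))"

definition upper_box_dim :: "'a::metric_space set \<Rightarrow> ereal" where
  "upper_box_dim F =
     Limsup (at_right 0) (\<lambda>\<delta>. ereal (ln (real (covering_number F \<delta>)) / - ln \<delta>))"

section \<open>Intermediate and quasi-Hausdorff dimensions\<close>

text \<open>
  Covers by sets \<open>U\<close> with \<open>\<delta>\<^bsup>1/\<theta>\<^esup> \<le> |U| \<le> \<delta>\<close> and \<open>\<Sum>|U|\<^sup>s \<le> \<epsilon>\<close>.  Since every summand is at
  least \<open>\<delta>\<^bsup>s/\<theta>\<^esup> > 0\<close>, such a cover is automatically finite; finiteness is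
  stated because \<^const>\<open>sum\<close> vanishes on infinite sets.
\<close>
definition intermediate_cover ::
    "'a::metric_space set \<Rightarrow> real \<Rightarrow> real \<Rightarrow> real \<Rightarrow> real \<Rightarrow> 'a set set \<Rightarrow> bool" where
  "intermediate_cover F \<theta> s \<delta> \<epsilon> \<C> \<longleftrightarrow>
     finite \<C> \<and> F \<subseteq> \<Union>\<C> \<and>
     (\<forall>U\<in>\<C>. bounded U \<and> \<delta> powr (1 / \<theta>) \<le> diameter U \<and> diameter U \<le> \<delta>) \<and>
     (\<Sum>U\<in>\<C>. diameter U powr s) \<le> \<epsilon>"

definition lower_intermediate_dim :: "real \<Rightarrow> 'a::metric_space set \<Rightarrow> ereal" where
  "lower_intermediate_dim \<theta> F =
     Inf (ereal ` {s. 0 \<le> s \<and>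
       (\<forall>\<epsilon>>0. \<forall>\<delta>0>0. \<exists>\<delta>. 0 < \<delta> \<and> \<delta> \<le> \<delta>0 \<and> (\<exists>\<C>. intermediate_cover F \<theta> s \<delta> \<epsilon> \<C>))})"

definition upper_intermediate_dim :: "real \<Rightarrow> 'a::metric_space set \<Rightarrow> ereal" where
  "upper_intermediate_dim \<theta> F =
     Inf (ereal ` {s. 0 \<le> s \<and>
       (\<forall>\<epsilon>>0. \<exists>\<delta>0>0. \<forall>\<delta>. 0 < \<delta> \<and> \<delta> \<le> \<delta>0 \<longrightarrow> (\<exists>\<C>. intermediate_cover F \<theta> s \<delta> \<epsilon> \<C>))})"

definition lower_quasi_Hausdorff_dim :: "'a::metric_space set \<Rightarrow> ereal" where
  "lower_quasi_Hausdorff_dim F = Lim (at_right 0) (\<lambda>\<theta>. lower_intermediate_dim \<theta> F)"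

definition upper_quasi_Hausdorff_dim :: "'a::metric_space set \<Rightarrow> ereal" where
  "upper_quasi_Hausdorff_dim F = Lim (at_right 0) (\<lambda>\<theta>. upper_intermediate_dim \<theta> F)"

section \<open>The Grassmannian and its Haar measure\<close>

definition orth_proj :: "'a::euclidean_space set \<Rightarrow> 'a \<Rightarrow> 'a" where
  "orth_proj V x = (THE y. y \<in> V \<and> (\<forall>v\<in>V. orthogonal (x - y) v))"

lemma orth_proj_unique:
  assumes "subspace V" "y \<in> V" "\<And>v. v \<in> V \<Longrightarrow> orthogonal (x - y) v"
  shows "orth_proj V x = y"
  unfolding orth_proj_def
proof (rule the_equality)
  show "y \<in> V \<and> (\<forall>v\<in>V. orthogonal (x - y) v)"
    using assms by blast
next
  fix z assume z: "z \<in> V \<and> (\<forall>v\<in>V. orthogonal (x - z) v)"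
  then have "z - y \<in> V"
    using assms by (simp add: subspace_diff)
  then have "inner (x - y) (z - y) = 0" "inner (x - z) (z - y) = 0"
    using assms z by (auto simp: orthogonal_def)
  then have "inner (z - y) (z - y) = 0"
    by (simp add: inner_diff_left inner_diff_right)
  then show "z = y" by simp
qed

lemma orth_proj:
  assumes "subspace V"
  shows "orth_proj V x \<in> V" and "\<And>v. v \<in> V \<Longrightarrow> orthogonal (x - orth_proj V x) v"
proof -
  obtain y z where y: "y \<in> span V" and z: "\<And>w. w \<in> span V \<Longrightarrow> orthogonal z w"
    and x: "x = y + z"
    using orthogonal_subspace_decomp_exists[of V x] by metis
  have V: "span V = V" using assms by (simp add: span_eq_iff)
  have "orth_proj V x = y"
    using orth_proj_unique[OF assms, of y x] y z x V by simp
  then show "orth_proj V x \<in> V" "\<And>v. v \<in> V \<Longrightarrow> orthogonal (x - orth_proj V x) v"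
    using x y z V by auto
qed

lemma linear_orth_proj:
  assumes "subspace V"
  shows "linear (orth_proj V)"
proof (rule linearI)
  fix x y
  have "orthogonal (x + y - (orth_proj V x + orth_proj V y)) v" if "v \<in> V" for v
    using orth_proj(2)[OF assms that, of x] orth_proj(2)[OF assms that, of y]
    by (simp add: orthogonal_def inner_diff_left inner_add_left)
  then show "orth_proj V (x + y) = orth_proj V x + orth_proj V y"
    using orth_proj(1)[OF assms]
    by (intro orth_proj_unique[OF assms]) (auto intro: subspace_add[OF assms])
next
  fix c x
  have "orthogonal (c *\<^sub>R x - c *\<^sub>R orth_proj V x) v" if "v \<in> V" for v
    using orth_proj(2)[OF assms that, of x]
    by (simp add: orthogonal_def inner_diff_left)
  then show "orth_proj V (c *\<^sub>R x) = c *\<^sub>R orth_proj V x"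
    using orth_proj(1)[OF assms]
    by (intro orth_proj_unique[OF assms]) (auto intro: subspace_scale[OF assms])
qed

definition grassmannian :: "nat \<Rightarrow> (real ^ 'n) set set" where
  "grassmannian m = {V. subspace V \<and> dim V = m}"

text \<open>
  The topology of \<open>G(n,m)\<close> is induced by the metric \<open>\<parallel>P\<^sub>V - P\<^sub>W\<parallel>\<close>.  As \<open>V \<mapsto> P\<^sub>V\<close> is injective,
  the Borel sets are the preimages of Borel sets of \<open>n \<times> n\<close> matrices.
\<close>
definition grassmannian_borel :: "nat \<Rightarrow> (real ^ 'n) set measure" where
  "grassmannian_borel m =
     vimage_algebra (grassmannian m) (\<lambda>V. matrix (orth_proj V)) (borel :: (real ^ 'n ^ 'n) measure)"

text \<open>
  \<open>M\<close> is the rotation-invariant Borel probability measure on \<open>G(n,m)\<close>; for \<open>m \<le> n\<close>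
  exactly one such measure exists, since \<open>O(n)\<close> is compact and acts transitively.
\<close>
definition grassmannian_haar :: "nat \<Rightarrow> (real ^ 'n) set measure \<Rightarrow> bool" where
  "grassmannian_haar m M \<longleftrightarrow>
     prob_space M \<and> sets M = sets (grassmannian_borel m) \<and>
     (\<forall>f. orthogonal_transformation f \<longrightarrow> distr M M (\<lambda>V. f ` V) = M)"

end

theory Submission
  imports Defs
begin

text \<open>
  Upper bounds hold for every plane \<open>V\<close>: orthogonal projection does not increase distances, and a
  bounded subset of an \<open>m\<close>-dimensional space has box dimension at most \<open>m\<close>.

  The lower bound is a potential-theoretic argument at one pair of scales at a time. Let
  \<open>0 < s < min m (dim\<^sub>q\<^sub>H E)\<close>. The intermediate dimensions increase with \<open>\<theta>\<close>, so the quasi-Hausdorff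
  dimension is a lower bound for all of them, and \<open>s < dim\<^sub>\<theta> E\<close> for every \<open>\<theta> > 0\<close>. Hence there are
  \<open>\<epsilon> > 0\<close> and arbitrarily small \<open>\<delta>\<close> (for the lower dimensions, all small \<open>\<delta>\<close>) such that no cover of \<open>E\<close> by
  sets of diameter between \<open>\<rho> = \<delta>\<^bsup>1/\<theta>\<^esup>\<close> and \<open>\<delta>\<close> has \<open>\<Sum>|U|\<^sup>s \<le> \<epsilon>\<close>. By a finite Frostman lemma (\<open>frostman_weights_exist\<close>) there is then a finitely supported
  measure \<open>\<mu>\<close> on \<open>E\<close>, of mass bounded below independently of \<open>\<delta>\<close>, that gives a ball of radius \<open>r\<close> mass
  at most \<open>r\<^sup>s\<close> for all \<open>r\<close> in a dyadic sequence from \<open>\<rho>\<close> to \<open>\<delta>\<close>, up to constants.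

  The probability that a random \<open>m\<close>-plane satisfies \<open>|P\<^sub>V z| \<le> \<rho>\<close> is at most a constant times
  \<open>(\<rho> / |z|)\<^sup>m\<close> (\<open>measure_small_projection_le\<close>). Integrating this kernel against \<open>\<mu>\<close>, pairs of points at
  distance up to \<open>\<delta>\<close> contribute at most a constant times \<open>\<rho>\<^sup>s\<close>, because \<open>s < m\<close> makes the
  dyadic sum geometric (\<open>dyadic_potential_le\<close>). Nothing is known about the mass of balls of radius
  above \<open>\<delta>\<close>, but pairs at such distances contribute only \<open>(\<rho> / \<delta>)\<^sup>m = \<rho>\<^bsup>(1 - \<theta>) m\<^esup>\<close>, which is at most
  \<open>\<rho>\<^sup>s\<close> as soon as \<open>s \<le> (1 - \<theta>) m\<close>. Values of \<open>s\<close> close to \<open>m\<close> force \<open>\<theta>\<close> to be small, and this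
  is why the limit \<open>\<theta> \<rightarrow> 0\<close> enters. So the expected \<open>\<mu> \<times> \<mu>\<close>-measure of the pairs with \<open>\<rho>\<close>-close
  projections is at most a constant times \<open>\<rho>\<^sup>s\<close> (\<open>expected_energy_le\<close>). By the Cauchy-Schwarz
  inequality this quantity is at least \<open>\<mu>(E)\<^sup>2\<close> divided by the covering number of \<open>P\<^sub>V E\<close> at scale \<open>\<rho>\<close>.

  Markov's inequality and the Borel-Cantelli lemma along scales decaying at least like \<open>2\<^bsup>-k\<^esup>\<close>
  give, for almost every \<open>V\<close>, covering numbers at least \<open>\<rho>\<^bsup>-t\<^esup>\<close> for any \<open>t < s\<close> at all late scales of the
  sequence. For the upper dimensions uncoverable scales are merely available arbitrarily far down,
  and a sequence of them suffices; for the lower dimensions every small scale is uncoverable, and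
  the geometric sequence \<open>\<delta> = 2\<^bsup>-k\<^esup>\<close> controls all scales.
\<close>

section \<open>Covering numbers\<close>

lemma covering_number_le_card:
  assumes "finite \<C>" "F \<subseteq> \<Union>\<C>" "\<And>U. U \<in> \<C> \<Longrightarrow> bounded U \<and> diameter U \<le> \<delta>"
  shows "covering_number F \<delta> \<le> card \<C>"
  unfolding covering_number_def by (rule Least_le) (use assms in blast)

lemma orthonormal_norm_le_sum:
  fixes B :: "'a::euclidean_space set"
  assumes "pairwise orthogonal B" "\<And>b. b \<in> B \<Longrightarrow> norm b = 1" "x \<in> span B" "finite B"
  shows "norm x \<le> (\<Sum>b\<in>B. \<bar>x \<bullet> b\<bar>)"
proof -
  have "norm x = norm (\<Sum>b\<in>B. (x \<bullet> b) *\<^sub>R b)"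
    using orthonormal_basis_expand[OF assms] by simp
  also have "\<dots> \<le> (\<Sum>b\<in>B. norm ((x \<bullet> b) *\<^sub>R b))"
    by (rule norm_sum)
  finally show ?thesis using assms(2) by simp
qed

text \<open>
  Cells of a cubic grid, with respect to an orthonormal basis of \<open>V\<close>, of side \<open>\<eta> / (dim V + 1)\<close>: the
  diameter of a cell is at most the sum of its side lengths. Adding one in the denominator admits
  \<open>dim V = 0\<close>. The exponent is the dimension of \<open>V\<close>, not of the ambient space; this gives both the upper
  bound \<open>m\<close> for projections and the volume of a neighbourhood of the orthogonal complement of a plane.
\<close>
lemma grid_cover_subspace:
  fixes V :: "'a::euclidean_space set"
  assumes V: "subspace V" and S: "S \<subseteq> V" "\<And>x. x \<in> S \<Longrightarrow> norm x \<le> R"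
    and R: "0 \<le> R" and \<eta>: "0 < \<eta>" "\<eta> \<le> 1"
  obtains \<C> where "finite \<C>" "S \<subseteq> \<Union>\<C>" "\<And>U. U \<in> \<C> \<Longrightarrow> U \<subseteq> S \<and> bounded U \<and> diameter U \<le> \<eta>"
    "real (card \<C>) \<le> (2 * R * (real (dim V) + 1) + 3) ^ dim V * \<eta> powr - real (dim V)"
proof -
  define d where "d = dim V"
  obtain B where B: "B \<subseteq> V" "pairwise orthogonal B" "\<And>x. x \<in> B \<Longrightarrow> norm x = 1"
      "independent B" "card B = d" "span B = V"
    using orthonormal_basis_subspace[OF V] d_def by metis
  have fin: "finite B" using B(4) by (rule independent_imp_finite)
  define t where "t = \<eta> / (real d + 1)"
  have t: "t > 0" unfolding t_def using \<eta> by (simp add: add_nonneg_pos)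
  define K where "K = \<lceil>R / t\<rceil>"
  have K0: "K \<ge> 0" unfolding K_def using R t
    by (simp add: le_ceiling_iff order_less_le_trans[of _ 0])
  define cell where "cell c = {x \<in> S. \<forall>b\<in>B. \<lfloor>(x \<bullet> b) / t\<rfloor> = c b}" for c
  define I where "I = (PiE B (\<lambda>_. {-K..K}))"
  have finI: "finite I" unfolding I_def using fin by (intro finite_PiE) auto
  have cardI: "card I = (2 * nat K + 1) ^ d"
    unfolding I_def using fin K0 B(5) by (simp add: card_PiE nat_add_distrib nat_mult_distrib)
  show ?thesis
  proof (rule that[of "cell ` I"])
    show "finite (cell ` I)" using finI by simp
    show "S \<subseteq> \<Union>(cell ` I)"
    proof
      fix x assume x: "x \<in> S"
      let ?c = "restrict (\<lambda>b. \<lfloor>(x \<bullet> b) / t\<rfloor>) B"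
      have "\<lfloor>(x \<bullet> b) / t\<rfloor> \<in> {-K..K}" if b: "b \<in> B" for b
      proof -
        have "\<bar>x \<bullet> b\<bar> \<le> R"
          using Cauchy_Schwarz_ineq2[of x b] B(3)[OF b] S(2)[OF x] by simp
        then have "\<bar>(x \<bullet> b) / t\<bar> \<le> R / t" using t by (simp add: divide_right_mono)
        then have "\<bar>(x \<bullet> b) / t\<bar> \<le> of_int K" unfolding K_def by linarith
        then have "- of_int K \<le> (x \<bullet> b) / t" "(x \<bullet> b) / t \<le> of_int K" by linarith+
        then show ?thesis by (simp, linarith)
      qed
      then have "?c \<in> I" unfolding I_def by auto
      moreover have "x \<in> cell ?c" unfolding cell_def using x by simp
      ultimately show "x \<in> \<Union>(cell ` I)" by blast
    qed
    show "U \<subseteq> S \<and> bounded U \<and> diameter U \<le> \<eta>" if U: "U \<in> cell ` I" for U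
    proof -
      obtain c where c: "U = cell c" using U by blast
      have sub: "U \<subseteq> S" unfolding c cell_def by blast
      have "bounded S" using S(2) by (auto simp: bounded_iff)
      moreover have "diameter U \<le> \<eta>"
      proof (rule diameter_le)
        show "U \<noteq> {} \<or> 0 \<le> \<eta>" using \<eta> by simp
        fix x y assume xy: "x \<in> U" "y \<in> U"
        have "x - y \<in> span B" using xy sub S(1) B(6) subspace_diff[OF V] by blast
        then have "norm (x - y) \<le> (\<Sum>b\<in>B. \<bar>(x - y) \<bullet> b\<bar>)"
          by (intro orthonormal_norm_le_sum B fin)
        also have "\<dots> \<le> (\<Sum>b\<in>B. t)"
        proof (rule sum_mono)
          fix b assume b: "b \<in> B"
          have "\<lfloor>(x \<bullet> b) / t\<rfloor> = \<lfloor>(y \<bullet> b) / t\<rfloor>" using xy b unfolding c cell_def by simp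
          then have "\<bar>(x \<bullet> b) / t - (y \<bullet> b) / t\<bar> \<le> 1" by linarith
          then have "\<bar>((x - y) \<bullet> b) / t\<bar> \<le> 1" by (simp add: inner_diff_left diff_divide_distrib)
          then show "\<bar>(x - y) \<bullet> b\<bar> \<le> t" using t by simp
        qed
        also have "\<dots> = real d * t" using B(5) by simp
        also have "\<dots> \<le> (real d + 1) * t" using t by (simp add: mult_right_mono)
        also have "\<dots> = \<eta>" unfolding t_def by (simp add: field_simps add_nonneg_pos)
        finally show "norm (x - y) \<le> \<eta>" .
      qed
      ultimately show ?thesis using sub bounded_subset by blast
    qed
    have "real (card (cell ` I)) \<le> real (card I)" using card_image_le[OF finI] by simp
    also have "\<dots> = (2 * of_int K + 1) ^ d"
    proof -
      have "real (2 * nat K + 1) = 2 * of_int K + 1" using K0 by simp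
      then show ?thesis unfolding cardI by (metis of_nat_power)
    qed
    also have "\<dots> \<le> ((2 * R * (real d + 1) + 3) / \<eta>) ^ d"
    proof (rule power_mono)
      have "of_int K \<le> R / t + 1" unfolding K_def by linarith
      also have "R / t = R * (real d + 1) / \<eta>" unfolding t_def by simp
      finally have "2 * of_int K + 1 \<le> 2 * (R * (real d + 1) / \<eta>) + 3" by linarith
      moreover have "3 \<le> 3 / \<eta>" using \<eta> by (simp add: le_divide_eq)
      ultimately show "2 * of_int K + 1 \<le> (2 * R * (real d + 1) + 3) / \<eta>"
        by (simp add: add_divide_distrib mult.assoc)
      show "(0::real) \<le> 2 * of_int K + 1" using K0 by simp
    qed
    also have "\<dots> = (2 * R * (real d + 1) + 3) ^ d * \<eta> powr - real d"
      using \<eta>(1) by (simp add: powr_minus powr_realpow power_divide divide_inverse[of _ "\<eta> ^ d"])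
    finally show "real (card (cell ` I))
        \<le> (2 * R * (real (dim V) + 1) + 3) ^ dim V * \<eta> powr - real (dim V)"
      unfolding d_def .
  qed
qed

lemma covering_number_attained:
  fixes F :: "'a::euclidean_space set"
  assumes "bounded F" "0 < \<delta>"
  obtains \<C> where "finite \<C>" "card \<C> = covering_number F \<delta>" "F \<subseteq> \<Union>\<C>"
    "\<And>U. U \<in> \<C> \<Longrightarrow> bounded U \<and> diameter U \<le> \<delta>"
proof -
  obtain R where R: "R > 0" "\<And>x. x \<in> F \<Longrightarrow> norm x \<le> R"
    using assms(1) bounded_pos by blast
  obtain \<C> where \<C>: "finite \<C>" "F \<subseteq> \<Union>\<C>"
      "\<And>U. U \<in> \<C> \<Longrightarrow> U \<subseteq> F \<and> bounded U \<and> diameter U \<le> min \<delta> 1"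
    using grid_cover_subspace[of UNIV F R "min \<delta> 1"] R assms(2) by (simp, metis)
  have "\<forall>U\<in>\<C>. bounded U \<and> diameter U \<le> \<delta>" using \<C>(3) by simp
  with \<C>(1,2) have "\<exists>k \<C>. finite \<C> \<and> card \<C> = k \<and> F \<subseteq> \<Union>\<C> \<and>
      (\<forall>U\<in>\<C>. bounded U \<and> diameter U \<le> \<delta>)" by blast
  from LeastI_ex[OF this, folded covering_number_def] show ?thesis
    using that by blast
qed

lemma covering_number_pos:
  fixes F :: "'a::euclidean_space set"
  assumes "bounded F" "0 < \<delta>" "F \<noteq> {}"
  shows "1 \<le> covering_number F \<delta>"
proof -
  obtain \<C> where C: "finite \<C>" "card \<C> = covering_number F \<delta>" "F \<subseteq> \<Union>\<C>"
    using covering_number_attained[OF assms(1,2)] by metis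
  then have "\<C> \<noteq> {}" using assms(3) by blast
  then have "0 < card \<C>" using C(1) by (simp add: card_gt_0_iff)
  then show ?thesis using C(2) by simp
qed

lemma covering_number_antimono:
  fixes F :: "'a::euclidean_space set"
  assumes "bounded F" "0 < \<delta>" "\<delta> \<le> \<delta>'"
  shows "covering_number F \<delta>' \<le> covering_number F \<delta>"
proof -
  obtain \<C> where "finite \<C>" "card \<C> = covering_number F \<delta>" "F \<subseteq> \<Union>\<C>"
      "\<And>U. U \<in> \<C> \<Longrightarrow> bounded U \<and> diameter U \<le> \<delta>"
    using covering_number_attained[OF assms(1,2)] by metis
  then show ?thesis using covering_number_le_card[of \<C> F \<delta>'] assms(3) by force
qed

lemma covering_number_image_le:
  fixes F :: "'a::euclidean_space set" and f :: "'a \<Rightarrow> 'b::euclidean_space"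
  assumes "bounded F" "0 < \<delta>" "\<And>x y. norm (f x - f y) \<le> norm (x - y)"
  shows "covering_number (f ` F) \<delta> \<le> covering_number F \<delta>"
proof -
  obtain \<C> where C: "finite \<C>" "card \<C> = covering_number F \<delta>" "F \<subseteq> \<Union>\<C>"
      "\<And>U. U \<in> \<C> \<Longrightarrow> bounded U \<and> diameter U \<le> \<delta>"
    using covering_number_attained[OF assms(1,2)] by metis
  have "covering_number (f ` F) \<delta> \<le> card ((`) f ` \<C>)"
  proof (rule covering_number_le_card)
    show "finite ((`) f ` \<C>)" "f ` F \<subseteq> \<Union>((`) f ` \<C>)" using C by blast+
    fix W assume "W \<in> (`) f ` \<C>"
    then obtain U where U: "U \<in> \<C>" "W = f ` U" by blast
    have dist: "norm (f x - f y) \<le> \<delta>" if "x \<in> U" "y \<in> U" for x y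
      using assms(3)[of x y] diameter_bounded_bound[of U x y] C(4)[OF U(1)] that
      by (simp add: dist_norm)
    then have "diameter W \<le> \<delta>"
      unfolding U(2) using assms(2) by (intro diameter_le) auto
    moreover have "bounded W"
      unfolding U(2) bounded_two_points using dist by (auto simp: dist_norm)
    ultimately show "bounded W \<and> diameter W \<le> \<delta>" by blast
  qed
  also have "\<dots> \<le> card \<C>" by (rule card_image_le[OF C(1)])
  finally show ?thesis unfolding C(2) .
qed

section \<open>Bounds for box dimensions\<close>

lemma tendsto_const_plus_over_neg_ln:
  fixes a b :: real
  shows "((\<lambda>\<delta>. ereal (a + b / - ln \<delta>)) \<longlongrightarrow> ereal a) (at_right 0)"
proof -
  have "filterlim (\<lambda>\<delta>::real. - ln \<delta>) at_top (at_right 0)"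
    using ln_at_0 by (simp add: filterlim_uminus_at_bot)
  then have "((\<lambda>\<delta>. b / - ln \<delta>) \<longlongrightarrow> 0) (at_right 0)"
    by (intro real_tendsto_divide_at_top[OF tendsto_const])
  then have "((\<lambda>\<delta>. a + b / - ln \<delta>) \<longlongrightarrow> a + 0) (at_right 0)"
    by (intro tendsto_intros)
  then show ?thesis by simp
qed

lemma eventually_at_right_0_less:
  assumes "0 < (c::real)"
  shows "eventually (\<lambda>\<delta>. 0 < \<delta> \<and> \<delta> < c) (at_right 0)"
  using assms eventually_at_right_less eventually_at_right_real[of 0 c] by simp

lemma lower_box_dim_nonneg:
  fixes F :: "'a::euclidean_space set"
  assumes "bounded F" "F \<noteq> {}"
  shows "0 \<le> lower_box_dim F"
  unfolding lower_box_dim_def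
proof (rule Liminf_bounded)
  show "\<forall>\<^sub>F \<delta> in at_right 0. 0 \<le> ereal (ln (real (covering_number F \<delta>)) / - ln \<delta>)"
    using eventually_at_right_0_less[OF zero_less_one]
  proof (eventually_elim, goal_cases)
    case (1 \<delta>)
    then have "1 \<le> covering_number F \<delta>" by (intro covering_number_pos assms) auto
    then have "0 \<le> ln (real (covering_number F \<delta>)) / - ln \<delta>"
      using 1 by (intro divide_nonneg_pos) auto
    then show ?case by (simp only: zero_ereal_def ereal_less_eq)
  qed
qed

lemma lower_box_dim_le_upper:
  "lower_box_dim F \<le> upper_box_dim F"
  unfolding lower_box_dim_def upper_box_dim_def by (rule Liminf_le_Limsup) simp

text \<open>
  The grid bound \<open>C \<delta>\<^bsup>- dim V\<^esup>\<close> turns into \<open>dim V + ln C / (- ln \<delta>)\<close> after taking logarithms.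
\<close>
lemma upper_box_dim_subspace_le:
  fixes V :: "'a::euclidean_space set"
  assumes V: "subspace V" and F: "F \<subseteq> V" "bounded F" "F \<noteq> {}"
  shows "upper_box_dim F \<le> ereal (real (dim V))"
proof -
  obtain R where R: "R > 0" "\<And>x. x \<in> F \<Longrightarrow> norm x \<le> R"
    using F(2) bounded_pos by blast
  define d where "d = dim V"
  define C where "C = (2 * R * (real d + 1) + 3) ^ d"
  have C: "C > 0" unfolding C_def using R(1) by (intro zero_less_power add_nonneg_pos mult_nonneg_nonneg) auto
  have "upper_box_dim F \<le> Limsup (at_right 0) (\<lambda>\<delta>. ereal (real d + ln C / - ln \<delta>))"
    unfolding upper_box_dim_def
  proof (rule Limsup_mono)
    show "\<forall>\<^sub>F \<delta> in at_right 0. ereal (ln (real (covering_number F \<delta>)) / - ln \<delta>)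
        \<le> ereal (real d + ln C / - ln \<delta>)"
      using eventually_at_right_0_less[OF zero_less_one]
    proof (eventually_elim, goal_cases)
      case (1 \<delta>)
      obtain \<C> where \<C>: "finite \<C>" "F \<subseteq> \<Union>\<C>"
          "\<And>U. U \<in> \<C> \<Longrightarrow> U \<subseteq> F \<and> bounded U \<and> diameter U \<le> \<delta>"
          "real (card \<C>) \<le> C * \<delta> powr - real d"
      proof (rule grid_cover_subspace[OF V F(1) R(2), of \<delta>])
        show "0 \<le> R" "0 < \<delta>" "\<delta> \<le> 1" using R(1) 1 by auto
      qed (simp_all add: C_def d_def)
      have "real (covering_number F \<delta>) \<le> C * \<delta> powr - real d"
        using covering_number_le_card[OF \<C>(1,2), of \<delta>] \<C>(3,4) by force
      moreover have "1 \<le> covering_number F \<delta>"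
        using 1 by (intro covering_number_pos F) auto
      ultimately have "ln (real (covering_number F \<delta>)) \<le> ln (C * \<delta> powr - real d)"
        by (subst ln_le_cancel_iff) auto
      also have "\<dots> = real d * - ln \<delta> + ln C"
        using C 1 by (simp add: ln_mult ln_powr)
      finally have "ln (real (covering_number F \<delta>)) / - ln \<delta> \<le> (real d * - ln \<delta> + ln C) / - ln \<delta>"
        using 1 by (intro divide_right_mono) auto
      also have "\<dots> = real d + ln C / - ln \<delta>"
        using 1 by (simp add: field_simps)
      finally show ?case by simp
    qed
  qed
  also have "\<dots> = ereal (real d)"
    by (rule lim_imp_Limsup[OF _ tendsto_const_plus_over_neg_ln]) simp
  finally show ?thesis unfolding d_def .
qed

lemma eventually_box_quotient_image_le:
  fixes F :: "'a::euclidean_space set" and f :: "'a \<Rightarrow> 'b::euclidean_space"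
  assumes "bounded F" "F \<noteq> {}" "bounded (f ` F)" "\<And>x y. norm (f x - f y) \<le> norm (x - y)"
  shows "\<forall>\<^sub>F \<delta> in at_right 0. ereal (ln (real (covering_number (f ` F) \<delta>)) / - ln \<delta>)
    \<le> ereal (ln (real (covering_number F \<delta>)) / - ln \<delta>)"
  using eventually_at_right_0_less[OF zero_less_one]
proof (eventually_elim, goal_cases)
  case (1 \<delta>)
  have "covering_number (f ` F) \<delta> \<le> covering_number F \<delta>"
    using 1 assms by (intro covering_number_image_le) auto
  moreover have "1 \<le> covering_number (f ` F) \<delta>"
    using 1 assms by (intro covering_number_pos) auto
  ultimately have "ln (real (covering_number (f ` F) \<delta>)) \<le> ln (real (covering_number F \<delta>))"
    by (subst ln_le_cancel_iff) auto
  then show ?case using 1 by (simp only: ereal_less_eq) (rule divide_right_mono, auto)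
qed

lemma box_dim_image_le:
  fixes F :: "'a::euclidean_space set" and f :: "'a \<Rightarrow> 'b::euclidean_space"
  assumes "bounded F" "F \<noteq> {}" "bounded (f ` F)" "\<And>x y. norm (f x - f y) \<le> norm (x - y)"
  shows "lower_box_dim (f ` F) \<le> lower_box_dim F"
    and "upper_box_dim (f ` F) \<le> upper_box_dim F"
  unfolding lower_box_dim_def upper_box_dim_def
  by (intro Liminf_mono Limsup_mono eventually_box_quotient_image_le[OF assms])+

lemma upper_box_dim_ge:
  fixes F :: "'a::metric_space set"
  assumes \<rho>: "\<And>k. 0 < \<rho> k" "\<rho> \<longlonglongrightarrow> 0"
    and N: "\<forall>\<^sub>F k in sequentially. \<rho> k powr - t \<le> real (covering_number F (\<rho> k))"
  shows "ereal t \<le> upper_box_dim F"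
  unfolding upper_box_dim_def Limsup_def
proof (rule INF_greatest, clarify)
  fix P assume P: "eventually P (at_right (0::real))"
  have "filterlim \<rho> (at_right 0) sequentially"
    using \<rho> by (auto simp: filterlim_at less_imp_neq[THEN not_sym])
  then have "\<forall>\<^sub>F k in sequentially. P (\<rho> k)" using P by (auto simp: filterlim_iff)
  moreover have "\<forall>\<^sub>F k in sequentially. \<rho> k < 1"
    using \<rho>(2) by (rule order_tendstoD) simp
  ultimately have "\<forall>\<^sub>F k in sequentially. P (\<rho> k) \<and> \<rho> k < 1 \<and>
      \<rho> k powr - t \<le> real (covering_number F (\<rho> k))"
    using N by eventually_elim blast
  then obtain k where k: "P (\<rho> k)" "\<rho> k < 1"
      "\<rho> k powr - t \<le> real (covering_number F (\<rho> k))"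
    using eventually_happens[of _ "sequentially"] sequentially_bot by blast
  have pos: "0 < \<rho> k powr - t" using \<rho>(1)[of k] by simp
  have "ln (\<rho> k powr - t) \<le> ln (real (covering_number F (\<rho> k)))"
    using pos k(3) order_less_le_trans[OF pos k(3)] by (simp only: ln_le_cancel_iff)
  then have "t * - ln (\<rho> k) \<le> ln (real (covering_number F (\<rho> k)))"
    using \<rho>(1)[of k] by (simp add: ln_powr)
  then have "t \<le> ln (real (covering_number F (\<rho> k))) / - ln (\<rho> k)"
    using k(2) \<rho>(1)[of k] by (subst pos_le_divide_eq) auto
  then show "ereal t \<le> (SUP x\<in>Collect P. ereal (ln (real (covering_number F x)) / - ln x))"
    using k(1) by (intro SUP_upper2[of "\<rho> k"]) auto
qed

text \<open>
  Covering numbers are monotone in the scale, so consecutive scales of a geometric sequence bound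
  those in between, with an error in the logarithm that vanishes relative to \<open>- ln \<delta>\<close>.
\<close>
lemma lower_box_dim_ge:
  fixes F :: "'a::euclidean_space set"
  assumes F: "bounded F" "F \<noteq> {}" and a: "0 < a" and t: "0 \<le> t"
    and N: "\<forall>\<^sub>F k in sequentially.
      2 powr (a * real k * t) \<le> real (covering_number F (2 powr - (a * real k)))"
  shows "ereal t \<le> lower_box_dim F"
proof -
  obtain k0 where k0: "\<And>k. k \<ge> k0 \<Longrightarrow>
      2 powr (a * real k * t) \<le> real (covering_number F (2 powr - (a * real k)))"
    using N unfolding eventually_sequentially by blast
  define b where "b = a * ln (2::real)"
  have b: "b > 0" unfolding b_def using a by simp
  have "ereal t = Liminf (at_right 0) (\<lambda>\<delta>. ereal (t + (- t * b) / - ln \<delta>))"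
    by (rule lim_imp_Liminf[symmetric, OF _ tendsto_const_plus_over_neg_ln]) simp
  also have "\<dots> \<le> lower_box_dim F"
    unfolding lower_box_dim_def
  proof (rule Liminf_mono)
    have pos: "0 < exp (- (b * (real k0 + 1)))" by simp
    show "\<forall>\<^sub>F \<delta> in at_right 0. ereal (t + (- t * b) / - ln \<delta>)
        \<le> ereal (ln (real (covering_number F \<delta>)) / - ln \<delta>)"
      using eventually_at_right_0_less[OF pos]
    proof (eventually_elim, goal_cases)
      case (1 \<delta>)
      then have "ln \<delta> < - (b * (real k0 + 1))" using ln_less_cancel_iff[of \<delta> "exp (- (b * (real k0 + 1)))"] by simp
      then have L: "b * (real k0 + 1) < - ln \<delta>" by simp
      then have Lpos: "0 < - ln \<delta>" using mult_pos_pos[OF b, of "real k0 + 1"] by linarith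
      \<comment> \<open>The index with \<open>2\<^bsup>- a (k + 1)\<^esup> < \<delta> \<le> 2\<^bsup>- a k\<^esup>\<close>, since \<open>b = a ln 2\<close>.\<close>
      define k where "k = nat \<lfloor>- ln \<delta> / b\<rfloor>"
      have Lb: "real k0 + 1 < - ln \<delta> / b" using L b by (subst pos_less_divide_eq) (simp_all add: mult.commute)
      have k: "real k \<le> - ln \<delta> / b" "- ln \<delta> / b - 1 \<le> real k" "k \<ge> k0"
        unfolding k_def using Lb by linarith+
      have "\<delta> \<le> exp (- (b * real k))"
      proof -
        have "b * real k \<le> - ln \<delta>" using k(1) pos_le_divide_eq[OF b] by (simp only: mult.commute)
        then have "ln \<delta> \<le> - (b * real k)" by simp
        then have "exp (ln \<delta>) \<le> exp (- (b * real k))" by simp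
        then show ?thesis using 1 by simp
      qed
      also have "exp (- (b * real k)) = 2 powr - (a * real k)"
        unfolding b_def powr_def by (simp add: mult_ac)
      finally have \<delta>: "\<delta> \<le> 2 powr - (a * real k)" .
      have "2 powr (a * real k * t) \<le> real (covering_number F (2 powr - (a * real k)))"
        by (rule k0[OF k(3)])
      also have "\<dots> \<le> real (covering_number F \<delta>)"
        using covering_number_antimono[OF F(1) _ \<delta>] 1 by simp
      finally have le: "2 powr (a * real k * t) \<le> real (covering_number F \<delta>)" .
      have pos: "0 < 2 powr (a * real k * t)" by simp
      have "ln (2 powr (a * real k * t)) \<le> ln (real (covering_number F \<delta>))"
        using pos le order_less_le_trans[OF pos le] by (simp only: ln_le_cancel_iff)
      then have *: "t * (b * real k) \<le> ln (real (covering_number F \<delta>))"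
        unfolding b_def by (simp add: ln_powr mult_ac)
      have "- ln \<delta> - b \<le> b * real k"
        using k(2) b by (simp add: field_simps)
      then have "t * (- ln \<delta> - b) \<le> t * (b * real k)" using t by (rule mult_left_mono)
      with * have "t * (- ln \<delta> - b) \<le> ln (real (covering_number F \<delta>))" by linarith
      then have "t * (- ln \<delta> - b) / - ln \<delta> \<le> ln (real (covering_number F \<delta>)) / - ln \<delta>"
        using Lpos by (intro divide_right_mono) auto
      moreover have "t * (- ln \<delta> - b) / - ln \<delta> = t + (- t * b) / - ln \<delta>"
        using Lpos by (simp add: field_simps)
      ultimately show ?case by (simp only: ereal_less_eq)
    qed
  qed
  finally show ?thesis .
qed

section \<open>Quasi-Hausdorff dimension as a lower bound for intermediate dimensions\<close>

text \<open>
  A monotone function converges to its infimum, so \<open>Lim\<close> denotes a genuine limit here.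
\<close>
lemma Lim_at_right_0_mono:
  fixes f :: "real \<Rightarrow> ereal"
  assumes "\<And>x y. 0 < x \<Longrightarrow> x \<le> y \<Longrightarrow> f x \<le> f y" and "0 < \<theta>"
  shows "Lim (at_right 0) f \<le> f \<theta>"
proof -
  define L where "L = (INF x\<in>{0<..}. f x)"
  have "(f \<longlongrightarrow> L) (at_right 0)"
  proof (rule order_tendstoI)
    fix c assume "c < L"
    then have "c < f x" if "x > 0" for x
    proof -
      have "L \<le> f x" unfolding L_def using that by (intro INF_lower) simp
      with \<open>c < L\<close> show ?thesis by (rule order_less_le_trans)
    qed
    then show "\<forall>\<^sub>F x in at_right 0. c < f x"
      by (intro eventually_mono[OF eventually_at_right_less])
  next
    fix c assume "L < c"
    then obtain y where y: "y > 0" "f y < c" unfolding L_def INF_less_iff by auto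
    show "\<forall>\<^sub>F x in at_right 0. f x < c"
      using eventually_at_right_0_less[OF y(1)]
    proof (eventually_elim, goal_cases)
      case (1 x)
      then have "f x \<le> f y" by (intro assms(1)) auto
      then show ?case using y(2) by (rule order_le_less_trans)
    qed
  qed
  then have "Lim (at_right 0) f = L" by (intro tendsto_Lim) simp
  then show ?thesis unfolding L_def using assms(2) by (simp add: INF_lower)
qed

text \<open>
  For \<open>\<delta> \<le> 1\<close> a smaller \<open>\<theta>\<close> admits more diameters; this makes the intermediate dimensions
  monotone in \<open>\<theta>\<close>.
\<close>
lemma intermediate_cover_antimono:
  assumes "intermediate_cover F \<theta>' s \<delta> \<epsilon> \<C>" "0 < \<theta>" "\<theta> \<le> \<theta>'" "0 < \<delta>" "\<delta> \<le> 1"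
  shows "intermediate_cover F \<theta> s \<delta> \<epsilon> \<C>"
proof -
  have "1 / \<theta>' \<le> 1 / \<theta>" using assms(2,3) by (simp add: frac_le)
  then have "\<delta> powr (1 / \<theta>) \<le> \<delta> powr (1 / \<theta>')"
    using assms(4,5) by (simp add: powr_mono')
  then show ?thesis using assms(1) unfolding intermediate_cover_def by force
qed

lemma lower_quasi_Hausdorff_dim_le:
  assumes "0 < \<theta>"
  shows "lower_quasi_Hausdorff_dim F \<le> lower_intermediate_dim \<theta> F"
  unfolding lower_quasi_Hausdorff_dim_def
proof (rule Lim_at_right_0_mono[OF _ assms])
  fix x y :: real assume xy: "0 < x" "x \<le> y"
  show "lower_intermediate_dim x F \<le> lower_intermediate_dim y F"
    unfolding lower_intermediate_dim_def
  proof (intro Inf_superset_mono image_mono subsetI CollectI conjI allI impI; elim CollectE conjE)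
    fix s \<epsilon> \<delta>0 :: real
    assume \<epsilon>: "\<epsilon> > 0" "\<delta>0 > 0" and A: "\<forall>\<epsilon>>0. \<forall>\<delta>0>0. \<exists>\<delta>>0. \<delta> \<le> \<delta>0 \<and> (\<exists>\<C>. intermediate_cover F y s \<delta> \<epsilon> \<C>)"
    have "0 < min \<delta>0 1" using \<epsilon>(2) by simp
    with A[rule_format, OF \<epsilon>(1)] obtain \<delta> \<C>
      where "\<delta> > 0" "\<delta> \<le> min \<delta>0 1" "intermediate_cover F y s \<delta> \<epsilon> \<C>" by metis
    moreover from this have "intermediate_cover F x s \<delta> \<epsilon> \<C>"
      by (intro intermediate_cover_antimono[OF _ xy]) auto
    ultimately show "\<exists>\<delta>>0. \<delta> \<le> \<delta>0 \<and> (\<exists>\<C>. intermediate_cover F x s \<delta> \<epsilon> \<C>)"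
      by auto
  qed
qed

lemma upper_quasi_Hausdorff_dim_le:
  assumes "0 < \<theta>"
  shows "upper_quasi_Hausdorff_dim F \<le> upper_intermediate_dim \<theta> F"
  unfolding upper_quasi_Hausdorff_dim_def
proof (rule Lim_at_right_0_mono[OF _ assms])
  fix x y :: real assume xy: "0 < x" "x \<le> y"
  show "upper_intermediate_dim x F \<le> upper_intermediate_dim y F"
    unfolding upper_intermediate_dim_def
  proof (intro Inf_superset_mono image_mono subsetI CollectI conjI allI impI; elim CollectE conjE)
    fix s \<epsilon> :: real
    assume \<epsilon>: "\<epsilon> > 0" and A: "\<forall>\<epsilon>>0. \<exists>\<delta>0>0. \<forall>\<delta>. 0 < \<delta> \<and> \<delta> \<le> \<delta>0 \<longrightarrow> (\<exists>\<C>. intermediate_cover F y s \<delta> \<epsilon> \<C>)"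
    from A[rule_format, OF \<epsilon>] obtain \<delta>0
      where \<delta>0: "\<delta>0 > 0" "\<And>\<delta>. 0 < \<delta> \<Longrightarrow> \<delta> \<le> \<delta>0 \<Longrightarrow> \<exists>\<C>. intermediate_cover F y s \<delta> \<epsilon> \<C>"
      by auto
    have "\<exists>\<C>. intermediate_cover F x s \<delta> \<epsilon> \<C>" if \<delta>: "0 < \<delta>" "\<delta> \<le> min \<delta>0 1" for \<delta>
    proof -
      obtain \<C> where "intermediate_cover F y s \<delta> \<epsilon> \<C>" using \<delta>0(2)[of \<delta>] \<delta> by auto
      then have "intermediate_cover F x s \<delta> \<epsilon> \<C>"
        using \<delta> by (intro intermediate_cover_antimono[OF _ xy]) auto
      then show ?thesis ..
    qed
    then show "\<exists>\<delta>0>0. \<forall>\<delta>. 0 < \<delta> \<and> \<delta> \<le> \<delta>0 \<longrightarrow> (\<exists>\<C>. intermediate_cover F x s \<delta> \<epsilon> \<C>)"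
      using \<delta>0(1) by (intro exI[of _ "min \<delta>0 1"]) auto
  qed
qed

lemma no_cover_if_less_lower_dim:
  assumes "0 \<le> s" "ereal s < lower_intermediate_dim \<theta> F"
  obtains \<epsilon> \<delta>0 where "0 < \<epsilon>" "0 < \<delta>0"
    "\<And>\<delta> \<C>. 0 < \<delta> \<Longrightarrow> \<delta> \<le> \<delta>0 \<Longrightarrow> \<not> intermediate_cover F \<theta> s \<delta> \<epsilon> \<C>"
proof -
  let ?S = "{s. 0 \<le> s \<and>
       (\<forall>\<epsilon>>0. \<forall>\<delta>0>0. \<exists>\<delta>. 0 < \<delta> \<and> \<delta> \<le> \<delta>0 \<and> (\<exists>\<C>. intermediate_cover F \<theta> s \<delta> \<epsilon> \<C>))}"
  have "s \<notin> ?S"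
  proof
    assume "s \<in> ?S"
    then have "lower_intermediate_dim \<theta> F \<le> ereal s"
      unfolding lower_intermediate_dim_def by (rule INF_lower)
    with assms(2) show False by simp
  qed
  then obtain \<epsilon> \<delta>0 where "0 < \<epsilon>" "0 < \<delta>0"
      and no: "\<not> (\<exists>\<delta>. 0 < \<delta> \<and> \<delta> \<le> \<delta>0 \<and> (\<exists>\<C>. intermediate_cover F \<theta> s \<delta> \<epsilon> \<C>))"
    using assms(1) by auto
  then show ?thesis by (intro that[of \<epsilon> \<delta>0]) auto
qed

lemma no_cover_if_less_upper_dim:
  assumes "0 \<le> s" "ereal s < upper_intermediate_dim \<theta> F"
  obtains \<epsilon> where "0 < \<epsilon>"
    "\<And>\<delta>0. 0 < \<delta>0 \<Longrightarrow> \<exists>\<delta>. 0 < \<delta> \<and> \<delta> \<le> \<delta>0 \<and> (\<forall>\<C>. \<not> intermediate_cover F \<theta> s \<delta> \<epsilon> \<C>)"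
proof -
  let ?S = "{s. 0 \<le> s \<and>
       (\<forall>\<epsilon>>0. \<exists>\<delta>0>0. \<forall>\<delta>. 0 < \<delta> \<and> \<delta> \<le> \<delta>0 \<longrightarrow> (\<exists>\<C>. intermediate_cover F \<theta> s \<delta> \<epsilon> \<C>))}"
  have "s \<notin> ?S"
  proof
    assume "s \<in> ?S"
    then have "upper_intermediate_dim \<theta> F \<le> ereal s"
      unfolding upper_intermediate_dim_def by (rule INF_lower)
    with assms(2) show False by simp
  qed
  then obtain \<epsilon> where "0 < \<epsilon>"
      and no: "\<not> (\<exists>\<delta>0>0. \<forall>\<delta>. 0 < \<delta> \<and> \<delta> \<le> \<delta>0 \<longrightarrow> (\<exists>\<C>. intermediate_cover F \<theta> s \<delta> \<epsilon> \<C>))"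
    using assms(1) by auto
  show ?thesis
  proof (rule that[OF \<open>0 < \<epsilon>\<close>])
    fix \<delta>0 :: real assume "0 < \<delta>0"
    with no show "\<exists>\<delta>. 0 < \<delta> \<and> \<delta> \<le> \<delta>0 \<and> (\<forall>\<C>. \<not> intermediate_cover F \<theta> s \<delta> \<epsilon> \<C>)"
      by auto
  qed
qed

section \<open>A finite Frostman lemma\<close>

text \<open>
  A greedy construction: the points are treated one after the other, and each receives the largest
  weight that violates none of the capacities \<open>c\<close>. Then some set containing the point has its
  capacity exhausted, and it stays exhausted because weights are never reduced.
\<close>
lemma saturated_weights_exist:
  fixes A :: "'i \<Rightarrow> 'a set" and c :: "'i \<Rightarrow> real"
  assumes "finite X" "finite I" "\<And>i. i \<in> I \<Longrightarrow> 0 \<le> c i" "\<And>x. x \<in> X \<Longrightarrow> \<exists>i\<in>I. x \<in> A i"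
  shows "\<exists>w. (\<forall>x. 0 \<le> w x) \<and> (\<forall>i\<in>I. sum w (X \<inter> A i) \<le> c i) \<and>
    (\<forall>x\<in>X. \<exists>i\<in>I. x \<in> A i \<and> sum w (X \<inter> A i) = c i)"
  using assms(1,4)
proof (induction X rule: finite_induct)
  case empty
  show ?case by (rule exI[of _ "\<lambda>_. 0"]) (use assms(3) in auto)
next
  case (insert x X)
  have "\<And>y. y \<in> X \<Longrightarrow> \<exists>i\<in>I. y \<in> A i" using insert.prems by blast
  from insert.IH[OF this] obtain w
    where w: "\<And>x. 0 \<le> w x" "\<And>i. i \<in> I \<Longrightarrow> sum w (X \<inter> A i) \<le> c i"
      "\<And>y. y \<in> X \<Longrightarrow> \<exists>i\<in>I. y \<in> A i \<and> sum w (X \<inter> A i) = c i"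
    by metis
  define slack where "slack i = c i - sum w (X \<inter> A i)" for i
  define S where "S = slack ` {i\<in>I. x \<in> A i}"
  define w' where "w' = w(x := Min S)"
  have S: "finite S" "S \<noteq> {}" unfolding S_def using assms(2) insert.prems[of x] by auto
  have "0 \<le> Min S" using S w(2) by (subst Min_ge_iff) (auto simp: S_def slack_def)
  then have nonneg: "0 \<le> w' y" for y unfolding w'_def using w(1) by simp
  have old: "sum w' (X \<inter> A i) = sum w (X \<inter> A i)" for i
    unfolding w'_def using insert.hyps(2) by (intro sum.cong) auto
  have new_in: "sum w' (insert x X \<inter> A i) = Min S + sum w (X \<inter> A i)" if "x \<in> A i" for i
  proof -
    have "insert x X \<inter> A i = insert x (X \<inter> A i)" using that by blast
    then show ?thesis using insert.hyps old by (simp add: w'_def)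
  qed
  have new_out: "sum w' (insert x X \<inter> A i) = sum w (X \<inter> A i)" if "x \<notin> A i" for i
  proof -
    have "insert x X \<inter> A i = X \<inter> A i" using that by blast
    then show ?thesis using old by simp
  qed
  have le: "sum w' (insert x X \<inter> A i) \<le> c i" if i: "i \<in> I" for i
  proof (cases "x \<in> A i")
    case True
    then have "Min S \<le> slack i" using S(1) i by (intro Min_le) (auto simp: S_def)
    then show ?thesis unfolding new_in[OF True] slack_def by simp
  next
    case False
    then show ?thesis using new_out w(2)[OF i] by simp
  qed
  have "\<exists>i\<in>I. y \<in> A i \<and> sum w' (insert x X \<inter> A i) = c i" if y: "y \<in> insert x X" for y
  proof (cases "y = x")
    case True
    obtain i where "i \<in> I" "x \<in> A i" "Min S = slack i"
      using Min_in[OF S] unfolding S_def by auto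
    then show ?thesis using True new_in[of i] by (intro bexI[of _ i]) (auto simp: slack_def)
  next
    case False
    then obtain i where i: "i \<in> I" "y \<in> A i" "sum w (X \<inter> A i) = c i" using w(3)[of y] y by auto
    have "c i \<le> sum w' (insert x X \<inter> A i)"
      unfolding i(3)[symmetric] old[symmetric]
      by (rule sum_mono2) (use insert.hyps(1) nonneg in auto)
    then show ?thesis using i le[OF i(1)] by (intro bexI[of _ i]) auto
  qed
  then show ?case using nonneg le by blast
qed

lemma finite_net_exists:
  fixes E :: "'a::euclidean_space set"
  assumes "bounded E" "0 < r"
  obtains X where "finite X" "X \<subseteq> E" "\<And>y. y \<in> E \<Longrightarrow> \<exists>x\<in>X. dist x y \<le> r"
proof -
  obtain \<C> where C: "finite \<C>" "E \<subseteq> \<Union>\<C>" "\<And>U. U \<in> \<C> \<Longrightarrow> bounded U \<and> diameter U \<le> r"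
    using covering_number_attained[OF assms] by metis
  define p where "p U = (SOME x. x \<in> U \<inter> E)" for U
  \<comment> \<open>Covering sets need not meet \<open>E\<close>; those that do not are discarded.\<close>
  define \<C>' where "\<C>' = {U\<in>\<C>. U \<inter> E \<noteq> {}}"
  have p: "p U \<in> U \<inter> E" if "U \<in> \<C>'" for U
    using that unfolding p_def \<C>'_def by (intro some_in_eq[THEN iffD2]) blast
  show ?thesis
  proof (rule that[of "p ` \<C>'"])
    show "finite (p ` \<C>')" unfolding \<C>'_def using C(1) by simp
    show "p ` \<C>' \<subseteq> E" using p by auto
    fix y assume y: "y \<in> E"
    then obtain U where U: "U \<in> \<C>" "y \<in> U" using C(2) by auto
    then have U': "U \<in> \<C>'" unfolding \<C>'_def using y by auto
    have "dist (p U) y \<le> diameter U"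
      using diameter_bounded_bound[of U "p U" y] C(3)[OF U(1)] p[OF U'] U(2) by auto
    then show "\<exists>x\<in>p ` \<C>'. dist x y \<le> r"
      using C(3)[OF U(1)] U' by (intro bexI[of _ "p U"]) auto
  qed
qed

text \<open>
  If the weights saturate some ball around every point, then disjoint saturated balls can be selected
  whose fivefold enlargements cover the support (Vitali). Their capacities sum to at most the
  total weight, while the enlargements form a cover of \<open>E\<close> with diameters in the admissible range. A small
  total weight would thus produce a cover that is excluded. The factor \<open>12\<close> is the diameter of a
  ball with sixfold radius: fivefold from Vitali, and one more radius to pass from the
  net \<open>X\<close> to all of \<open>E\<close>.
\<close>
lemma frostman_weights_exist:
  fixes E :: "'a::euclidean_space set"
  assumes E: "bounded E" and s: "0 \<le> s" and r: "0 < r"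
    and scales: "\<delta> powr (1 / \<theta>) \<le> 12 * r" "12 * r * 2 ^ J \<le> \<delta>"
    and no_cover: "\<And>\<C>. \<not> intermediate_cover E \<theta> s \<delta> \<epsilon> \<C>"
  obtains X w where "finite X" "X \<subseteq> E" "\<And>x. 0 \<le> w x"
    "\<And>x j. x \<in> X \<Longrightarrow> j \<le> J \<Longrightarrow> sum w (X \<inter> cball x (r * 2 ^ j)) \<le> (r * 2 ^ j) powr s"
    "\<epsilon> / 12 powr s < sum w X"
proof -
  obtain X where X: "finite X" "X \<subseteq> E" "\<And>y. y \<in> E \<Longrightarrow> \<exists>x\<in>X. dist x y \<le> r"
    using finite_net_exists[OF E r] by metis
  define rad where "rad i = r * 2 ^ snd i" for i :: "'a \<times> nat"
  define A where "A i = cball (fst i) (rad i)" for i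
  have rad: "r \<le> rad i" for i unfolding rad_def using r by simp
  have radpos: "0 < rad i" for i using rad[of i] r by simp
  have "\<exists>w. (\<forall>x. 0 \<le> w x) \<and> (\<forall>i\<in>X \<times> {..J}. sum w (X \<inter> A i) \<le> rad i powr s) \<and>
    (\<forall>x\<in>X. \<exists>i\<in>X \<times> {..J}. x \<in> A i \<and> sum w (X \<inter> A i) = rad i powr s)"
  proof (rule saturated_weights_exist)
    show "\<exists>i\<in>X \<times> {..J}. x \<in> A i" if "x \<in> X" for x
      using that r by (intro bexI[of _ "(x, 0)"]) (auto simp: A_def rad_def)
  qed (use X(1) in auto)
  then obtain w where w: "\<And>x. 0 \<le> w x" "\<And>i. i \<in> X \<times> {..J} \<Longrightarrow> sum w (X \<inter> A i) \<le> rad i powr s"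
      "\<And>x. x \<in> X \<Longrightarrow> \<exists>i\<in>X \<times> {..J}. x \<in> A i \<and> sum w (X \<inter> A i) = rad i powr s"
    by metis
  define K where "K = {i \<in> X \<times> {..J}. sum w (X \<inter> A i) = rad i powr s}"
  have finK: "finite K" unfolding K_def using X(1) by auto
  have "X \<subseteq> (\<Union>i\<in>K. cball (fst i) (rad i))" using w(3) unfolding K_def A_def by blast
  moreover have "0 < rad i \<and> rad i \<le> r * 2 ^ J" if "i \<in> K" for i
    using that radpos r unfolding K_def rad_def by (auto intro!: power_increasing)
  ultimately obtain C where C: "C \<subseteq> K"
      "pairwise (\<lambda>i j. disjnt (cball (fst i) (rad i)) (cball (fst j) (rad j))) C"
      "X \<subseteq> (\<Union>i\<in>C. cball (fst i) (5 * rad i))"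
    by (rule Vitali_covering_lemma_cballs)
  have finC: "finite C" using C(1) finK by (rule finite_subset)
  have disj: "A i \<inter> A j = {}" if "i \<in> C" "j \<in> C" "i \<noteq> j" for i j
    using C(2) that unfolding pairwise_def disjnt_def A_def by blast
  define \<U> where "\<U> = (\<lambda>i. cball (fst i) (6 * rad i)) ` C"
  have diam: "diameter (cball (fst i) (6 * rad i)) = 12 * rad i" for i :: "'a \<times> nat"
    using radpos[of i] by simp
  have sum_le: "(\<Sum>U\<in>\<U>. diameter U powr s) \<le> 12 powr s * sum w X"
  proof -
    have "(\<Sum>U\<in>\<U>. diameter U powr s) \<le> (\<Sum>i\<in>C. diameter (cball (fst i) (6 * rad i)) powr s)"
      unfolding \<U>_def by (rule sum_image_le[OF finC, unfolded o_def]) auto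
    also have "\<dots> = (\<Sum>i\<in>C. 12 powr s * sum w (X \<inter> A i))"
    proof (rule sum.cong[OF refl])
      fix i assume "i \<in> C"
      then have "sum w (X \<inter> A i) = rad i powr s" using C(1) unfolding K_def by blast
      then show "diameter (cball (fst i) (6 * rad i)) powr s = 12 powr s * sum w (X \<inter> A i)"
        unfolding diam using radpos[of i] by (simp add: powr_mult)
    qed
    also have "\<dots> = 12 powr s * (\<Sum>i\<in>C. sum w (X \<inter> A i))" by (rule sum_distrib_left[symmetric])
    also have "(\<Sum>i\<in>C. sum w (X \<inter> A i)) = sum w (\<Union>i\<in>C. X \<inter> A i)"
    proof (rule sum.UNION_disjoint[symmetric, OF finC])
      show "\<forall>i\<in>C. finite (X \<inter> A i)" using X(1) by simp
      show "\<forall>i\<in>C. \<forall>j\<in>C. i \<noteq> j \<longrightarrow> X \<inter> A i \<inter> (X \<inter> A j) = {}" using disj by blast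
    qed
    also have "\<dots> \<le> sum w X" by (rule sum_mono2) (use X(1) w(1) in auto)
    finally show ?thesis by simp
  qed
  have "\<epsilon> / 12 powr s < sum w X"
  proof (rule ccontr)
    assume "\<not> \<epsilon> / 12 powr s < sum w X"
    then have "12 powr s * sum w X \<le> \<epsilon>" by (simp add: field_simps)
    have "intermediate_cover E \<theta> s \<delta> \<epsilon> \<U>"
      unfolding intermediate_cover_def
    proof (intro conjI ballI)
      show "finite \<U>" unfolding \<U>_def using finC by simp
      show "E \<subseteq> \<Union>\<U>"
      proof
        fix y assume "y \<in> E"
        then obtain x where x: "x \<in> X" "dist x y \<le> r" using X(3) by blast
        then obtain i where i: "i \<in> C" "dist (fst i) x \<le> 5 * rad i" using C(3) by auto
        have "dist (fst i) y \<le> 6 * rad i"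
          using dist_triangle[of "fst i" y x] x(2) i(2) rad[of i] by linarith
        then show "y \<in> \<Union>\<U>" unfolding \<U>_def using i(1) by auto
      qed
      show "(\<Sum>U\<in>\<U>. diameter U powr s) \<le> \<epsilon>"
        using sum_le \<open>12 powr s * sum w X \<le> \<epsilon>\<close> by linarith
    next
      fix U assume "U \<in> \<U>"
      then obtain i where i: "i \<in> C" and U: "U = cball (fst i) (6 * rad i)" unfolding \<U>_def by blast
      have "snd i \<le> J" using i C(1) unfolding K_def by auto
      then have "12 * rad i \<le> 12 * r * 2 ^ J"
        unfolding rad_def using r by (auto intro!: power_increasing)
      then show "diameter U \<le> \<delta>" unfolding U diam using scales(2) by linarith
      show "\<delta> powr (1 / \<theta>) \<le> diameter U" unfolding U diam using scales(1) rad[of i] by linarith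
      show "bounded U" unfolding U by simp
    qed
    with no_cover show False by blast
  qed
  moreover have "sum w (X \<inter> cball x (r * 2 ^ j)) \<le> (r * 2 ^ j) powr s" if "x \<in> X" "j \<le> J" for x j
    using w(2)[of "(x, j)"] that by (simp add: A_def rad_def)
  ultimately show ?thesis by (intro that[OF X(1,2) w(1)])
qed

section \<open>Energies\<close>

text \<open>
  Assign each point of \<open>X\<close> to one covering set containing its image. Points of the same class have
  \<open>\<rho>\<close>-close images, so the sum of the squared class weights is at most the energy on the right, and the
  Cauchy-Schwarz inequality compares it with the square of the total weight.
\<close>
lemma weight_square_le_covering_number_times_energy:
  fixes E :: "'a set" and f :: "'a \<Rightarrow> 'b::euclidean_space" and w :: "'a \<Rightarrow> real"
  assumes X: "finite X" "X \<subseteq> E" and w: "\<And>x. 0 \<le> w x" and E: "bounded (f ` E)" and \<rho>: "0 < \<rho>"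
  shows "(sum w X)\<^sup>2 \<le> real (covering_number (f ` E) \<rho>) *
    (\<Sum>x\<in>X. w x * sum w {y\<in>X. dist (f x) (f y) \<le> \<rho>})"
proof -
  obtain \<C> where C: "finite \<C>" "card \<C> = covering_number (f ` E) \<rho>" "f ` E \<subseteq> \<Union>\<C>"
      "\<And>U. U \<in> \<C> \<Longrightarrow> bounded U \<and> diameter U \<le> \<rho>"
    using covering_number_attained[OF E \<rho>] by metis
  have "\<forall>x\<in>X. \<exists>U\<in>\<C>. f x \<in> U" using X(2) C(3) by blast
  then obtain g where g: "\<And>x. x \<in> X \<Longrightarrow> g x \<in> \<C>" "\<And>x. x \<in> X \<Longrightarrow> f x \<in> g x" by metis
  define W where "W U = sum w {x\<in>X. g x = U}" for U
  have gX: "g ` X \<subseteq> \<C>" using g(1) by blast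
  have "sum w X = (\<Sum>U\<in>\<C>. 1 * W U)"
    unfolding W_def mult_1 by (rule sum.group[symmetric, OF X(1) C(1) gX])
  then have "(sum w X)\<^sup>2 \<le> (\<Sum>U\<in>\<C>. 1\<^sup>2) * (\<Sum>U\<in>\<C>. (W U)\<^sup>2)"
    by (simp only: Cauchy_Schwarz_ineq_sum)
  then have CS: "(sum w X)\<^sup>2 \<le> real (covering_number (f ` E) \<rho>) * (\<Sum>U\<in>\<C>. (W U)\<^sup>2)"
    using C(2) by simp
  have "(\<Sum>U\<in>\<C>. (W U)\<^sup>2) = (\<Sum>U\<in>\<C>. \<Sum>x\<in>{x\<in>X. g x = U}. w x * W (g x))"
  proof (rule sum.cong[OF refl])
    fix U
    have "(\<Sum>x\<in>{x\<in>X. g x = U}. w x * W (g x)) = (\<Sum>x\<in>{x\<in>X. g x = U}. w x * W U)"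
      by (rule sum.cong) auto
    also have "\<dots> = W U * W U" unfolding sum_distrib_right[symmetric] by (simp add: W_def)
    finally show "(W U)\<^sup>2 = (\<Sum>x\<in>{x\<in>X. g x = U}. w x * W (g x))" by (simp add: power2_eq_square)
  qed
  also have "\<dots> = (\<Sum>x\<in>X. w x * W (g x))" by (rule sum.group[OF X(1) C(1) gX])
  also have "\<dots> \<le> (\<Sum>x\<in>X. w x * sum w {y\<in>X. dist (f x) (f y) \<le> \<rho>})"
  proof (intro sum_mono mult_left_mono w)
    fix x assume x: "x \<in> X"
    show "W (g x) \<le> sum w {y\<in>X. dist (f x) (f y) \<le> \<rho>}"
      unfolding W_def
    proof (rule sum_mono2)
      show "{y\<in>X. g y = g x} \<subseteq> {y\<in>X. dist (f x) (f y) \<le> \<rho>}"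
      proof clarify
        fix y assume y: "y \<in> X" "g y = g x"
        then have "dist (f x) (f y) \<le> diameter (g x)"
          using diameter_bounded_bound[of "g x" "f x" "f y"] g(2)[OF x] g(2)[OF y(1)] C(4) g(1)[OF x]
          by simp
        then show "dist (f x) (f y) \<le> \<rho>" using C(4)[OF g(1)[OF x]] by linarith
      qed
    qed (use X(1) w in auto)
  qed
  finally have "real (covering_number (f ` E) \<rho>) * (\<Sum>U\<in>\<C>. (W U)\<^sup>2)
      \<le> real (covering_number (f ` E) \<rho>) * (\<Sum>x\<in>X. w x * sum w {y\<in>X. dist (f x) (f y) \<le> \<rho>})"
    by (rule mult_left_mono) simp
  with CS show ?thesis by (rule order_trans)
qed

text \<open>
  Up to the factor \<open>C\<close>, the kernel \<open>\<phi>\<close> is dominated by \<open>2\<^sup>m \<Sum>\<^bsub>j\<le>J\<^esub> 2\<^bsup>-jm\<^esup> 1\<^bsub>d \<le> r 2\<^sup>j\<^esub> + 2\<^bsup>-Jm\<^esup>\<close>; with the mass bound for the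
  balls, the sum becomes geometric with ratio \<open>2\<^bsup>s - m\<^esup> < 1\<close>. The last term collects the points
  beyond the largest radius, where only their total mass is known.
\<close>
lemma dyadic_potential_le:
  fixes d w \<phi> :: "'a \<Rightarrow> real"
  assumes X: "finite X" and w: "\<And>y. 0 \<le> w y" and r: "0 < r" and s: "s < real m" and C: "1 \<le> C"
    and \<phi>: "\<And>y. \<phi> y \<le> 1" "\<And>y. 0 < d y \<Longrightarrow> \<phi> y \<le> C * (r / d y) ^ m"
    and mass: "\<And>j. j \<le> J \<Longrightarrow> sum w {y\<in>X. d y \<le> r * 2 ^ j} \<le> (r * 2 ^ j) powr s"
  shows "(\<Sum>y\<in>X. w y * \<phi> y)
    \<le> C * (2 ^ m / (1 - 2 powr (s - real m)) * r powr s + (1 / 2 ^ J) ^ m * sum w X)"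
proof -
  define q where "q = (2::real) powr (s - real m)"
  have q: "0 < q" "q < 1" unfolding q_def using s powr_less_mono[of "s - real m" 0 2] by auto
  define ball where "ball j = {y\<in>X. d y \<le> r * 2 ^ j}" for j :: nat
  have pointwise: "\<phi> y \<le> C * (2 ^ m * (\<Sum>j\<le>J. (1 / 2 ^ j) ^ m * indicator (ball j) y) + (1 / 2 ^ J) ^ m)"
    (is "_ \<le> C * (2 ^ m * ?S + ?T)") if y: "y \<in> X" for y
  proof (cases "\<exists>j\<le>J. d y \<le> r * 2 ^ j")
    case True
    \<comment> \<open>For \<open>j > 0\<close>, minimality makes \<open>d y\<close> exceed \<open>r 2\<^bsup>j - 1\<^esup>\<close>, at the cost of the factor \<open>2\<^sup>m\<close>.\<close>
    define j where "j = (LEAST j. d y \<le> r * 2 ^ j)"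
    from True obtain j' where j': "j' \<le> J" "d y \<le> r * 2 ^ j'" by blast
    have j: "d y \<le> r * 2 ^ j" unfolding j_def by (rule LeastI[of _ j']) (rule j'(2))
    have jJ: "j \<le> J" unfolding j_def by (rule order_trans[OF Least_le]) (use j' in auto)
    have "\<phi> y \<le> C * (2 ^ m * (1 / 2 ^ j) ^ m)"
    proof (cases j)
      case 0
      have "1 * 1 \<le> C * 2 ^ m" using C by (intro mult_mono) auto
      then show ?thesis using 0 \<phi>(1)[of y] by simp
    next
      case (Suc k)
      have "\<not> d y \<le> r * 2 ^ k" using not_less_Least[of k "\<lambda>j. d y \<le> r * 2 ^ j"] Suc
        unfolding j_def by auto
      then have k: "r * 2 ^ k < d y" by simp
      have dpos: "0 < d y" using r by (intro order_less_trans[OF _ k]) simp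
      have "r / d y \<le> 1 / 2 ^ k" using k dpos by (simp add: field_simps)
      then have "C * (r / d y) ^ m \<le> C * (1 / 2 ^ k) ^ m"
        using C r dpos by (intro mult_left_mono power_mono) auto
      also have "(1 / 2 ^ k :: real) = 2 * (1 / 2 ^ j)" unfolding Suc by simp
      also have "\<dots> ^ m = 2 ^ m * (1 / 2 ^ j) ^ m" by (rule power_mult_distrib)
      finally show ?thesis using \<phi>(2)[OF dpos] by linarith
    qed
    also have "C * (2 ^ m * (1 / 2 ^ j) ^ m) \<le> C * (2 ^ m * ?S)"
    proof (intro mult_left_mono)
      have "(1 / 2 ^ j) ^ m = (\<Sum>j\<in>{j}. (1 / 2 ^ j) ^ m * indicator (ball j) y :: real)"
        using y j unfolding ball_def by simp
      also have "\<dots> \<le> ?S" by (rule sum_mono2) (use jJ in auto)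
      finally show "(1 / 2 ^ j) ^ m \<le> ?S" .
    qed (use C in auto)
    also have "C * (2 ^ m * ?S) \<le> C * (2 ^ m * ?S + ?T)" using C by (intro mult_left_mono) auto
    finally show ?thesis .
  next
    case False
    then have k: "r * 2 ^ J < d y" by auto
    have dpos: "0 < d y" using r by (intro order_less_trans[OF _ k]) simp
    have "r / d y \<le> 1 / 2 ^ J" using k dpos by (simp add: field_simps)
    then have "C * (r / d y) ^ m \<le> C * ?T"
      using C r dpos by (intro mult_left_mono power_mono) auto
    moreover have "0 \<le> C * (2 ^ m * ?S)"
      using C by (intro mult_nonneg_nonneg sum_nonneg) auto
    ultimately show ?thesis using \<phi>(2)[OF dpos] by (simp add: distrib_left)
  qed
  have "(\<Sum>y\<in>X. w y * \<phi> y) \<le> (\<Sum>y\<in>X. w y * (C * (2 ^ m * (\<Sum>j\<le>J. (1 / 2 ^ j) ^ m * indicator (ball j) y) + (1 / 2 ^ J) ^ m)))"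
    by (intro sum_mono mult_left_mono pointwise w)
  also have "\<dots> = (\<Sum>y\<in>X. C * 2 ^ m * (\<Sum>j\<le>J. (1 / 2 ^ j) ^ m * (w y * indicator (ball j) y))
      + C * (1 / 2 ^ J) ^ m * w y)"
  proof (rule sum.cong[OF refl])
    fix y
    have "w y * (\<Sum>j\<le>J. (1 / 2 ^ j) ^ m * indicator (ball j) y)
        = (\<Sum>j\<le>J. (1 / 2 ^ j) ^ m * (w y * indicator (ball j) y))"
      by (simp only: sum_distrib_left mult.left_commute)
    from arg_cong[OF this, of "\<lambda>u. C * 2 ^ m * u"]
    show "w y * (C * (2 ^ m * (\<Sum>j\<le>J. (1 / 2 ^ j) ^ m * indicator (ball j) y) + (1 / 2 ^ J) ^ m))
        = C * 2 ^ m * (\<Sum>j\<le>J. (1 / 2 ^ j) ^ m * (w y * indicator (ball j) y)) + C * (1 / 2 ^ J) ^ m * w y"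
      by (simp add: algebra_simps)
  qed
  also have "\<dots> = C * 2 ^ m * (\<Sum>y\<in>X. \<Sum>j\<le>J. (1 / 2 ^ j) ^ m * (w y * indicator (ball j) y))
      + C * (1 / 2 ^ J) ^ m * sum w X"
    by (simp only: sum.distrib sum_distrib_left[symmetric])
  also have "\<dots> = C * (2 ^ m * (\<Sum>y\<in>X. \<Sum>j\<le>J. (1 / 2 ^ j) ^ m * (w y * indicator (ball j) y))
      + (1 / 2 ^ J) ^ m * sum w X)"
    by (simp only: distrib_left mult.assoc)
  also have "(\<Sum>y\<in>X. \<Sum>j\<le>J. (1 / 2 ^ j) ^ m * (w y * indicator (ball j) y))
      = (\<Sum>j\<le>J. (1 / 2 ^ j) ^ m * sum w (ball j))"
  proof -
    have "(\<Sum>y\<in>X. w y * indicator (ball j) y) = sum w (ball j)" for j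
    proof -
      have "(\<Sum>y\<in>X. w y * indicator (ball j) y) = sum w (X \<inter> ball j)"
        unfolding sum.inter_restrict[OF X] by (intro sum.cong) auto
      also have "X \<inter> ball j = ball j" unfolding ball_def by blast
      finally show ?thesis .
    qed
    then show ?thesis by (subst sum.swap) (simp add: sum_distrib_left[symmetric])
  qed
  finally have bound: "(\<Sum>y\<in>X. w y * \<phi> y)
      \<le> C * (2 ^ m * (\<Sum>j\<le>J. (1 / 2 ^ j) ^ m * sum w (ball j)) + (1 / 2 ^ J) ^ m * sum w X)" .
  have "(\<Sum>j\<le>J. (1 / 2 ^ j) ^ m * sum w (ball j)) \<le> (\<Sum>j\<le>J. r powr s * q ^ j)"
  proof (rule sum_mono)
    fix j assume j: "j \<in> {..J}"
    have pw: "(1 / 2 ^ j) ^ m = (2::real) powr - (real j * real m)"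
      by (simp add: powr_minus powr_realpow[symmetric] powr_powr power_one_over inverse_eq_divide flip: power_mult)
    have "2 powr - (real j * real m) * sum w (ball j)
        \<le> 2 powr - (real j * real m) * (r * 2 ^ j) powr s"
      unfolding ball_def using j by (intro mult_left_mono mass) auto
    also have "(r * 2 ^ j) powr s = r powr s * 2 powr (real j * s)"
      using r by (simp add: powr_mult powr_powr flip: powr_realpow)
    also have "2 powr - (real j * real m) * (r powr s * 2 powr (real j * s)) = r powr s * q ^ j"
    proof -
      have "q ^ j = 2 powr (real j * (s - real m))"
        unfolding q_def by (simp add: powr_power)
      also have "\<dots> = 2 powr (- (real j * real m) + real j * s)" by (simp add: algebra_simps)
      also have "\<dots> = 2 powr - (real j * real m) * 2 powr (real j * s)" by (rule powr_add)
      finally show ?thesis by simp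
    qed
    finally show "(1 / 2 ^ j) ^ m * sum w (ball j) \<le> r powr s * q ^ j" unfolding pw .
  qed
  also have "\<dots> = r powr s * (\<Sum>j\<le>J. q ^ j)" by (simp add: sum_distrib_left)
  also have "r powr s * (\<Sum>j\<le>J. q ^ j) \<le> r powr s * (1 / (1 - q))"
  proof (rule mult_left_mono)
    have "(\<Sum>j\<le>J. q ^ j) = (1 - q ^ Suc J) / (1 - q)" using q by (simp add: sum_gp0)
    also have "\<dots> \<le> 1 / (1 - q)" using q by (intro divide_right_mono) auto
    finally show "(\<Sum>j\<le>J. q ^ j) \<le> 1 / (1 - q)" .
  qed simp
  finally have "2 ^ m * (\<Sum>j\<le>J. (1 / 2 ^ j) ^ m * sum w (ball j)) \<le> 2 ^ m * (r powr s * (1 / (1 - q)))"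
    by (rule mult_left_mono) simp
  also have "\<dots> = 2 ^ m / (1 - q) * r powr s" by simp
  finally have "C * (2 ^ m * (\<Sum>j\<le>J. (1 / 2 ^ j) ^ m * sum w (ball j)) + (1 / 2 ^ J) ^ m * sum w X)
      \<le> C * (2 ^ m / (1 - q) * r powr s + (1 / 2 ^ J) ^ m * sum w X)"
    using C by (intro mult_left_mono add_right_mono) auto
  with bound show ?thesis unfolding q_def by (rule order_trans)
qed

section \<open>The probability that a projection is small\<close>

lemma norm_orth_proj_le:
  assumes "subspace V"
  shows "norm (orth_proj V x) \<le> norm x"
proof -
  have "orthogonal (x - orth_proj V x) (orth_proj V x)"
    using orth_proj[OF assms] by blast
  then have "orth_proj V x \<bullet> orth_proj V x = x \<bullet> orth_proj V x"
    by (simp add: orthogonal_def inner_diff_left)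
  then have "norm (orth_proj V x) * norm (orth_proj V x) \<le> norm x * norm (orth_proj V x)"
    using norm_cauchy_schwarz[of x "orth_proj V x"] by (simp add: dot_square_norm power2_eq_square)
  then show ?thesis by (cases "norm (orth_proj V x) = 0") (auto simp: mult_le_cancel_right)
qed

lemma orth_proj_diff:
  assumes "subspace V"
  shows "orth_proj V (x - y) = orth_proj V x - orth_proj V y"
  using linear_diff[OF linear_orth_proj[OF assms]] .

lemma orth_proj_orthogonal_image:
  assumes V: "subspace V" and f: "orthogonal_transformation f"
  shows "orth_proj (f ` V) (f x) = f (orth_proj V x)"
proof (rule orth_proj_unique)
  have lin: "linear f" using f by (rule orthogonal_transformation_linear)
  show "subspace (f ` V)" using lin V by (rule linear_subspace_image)
  show "f (orth_proj V x) \<in> f ` V" using orth_proj(1)[OF V] by blast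
  fix v assume "v \<in> f ` V"
  then obtain u where u: "u \<in> V" "v = f u" by blast
  have "f x - f (orth_proj V x) = f (x - orth_proj V x)" using lin by (simp add: linear_diff)
  then show "orthogonal (f x - f (orth_proj V x)) v"
    using orth_proj(2)[OF V u(1), of x] f u(2)
    by (simp add: orthogonal_def orthogonal_transformation_def)
qed

text \<open>
  The slab is the \<open>t\<close>-neighbourhood of \<open>V\<^sup>\<bottom>\<close> inside the unit ball. A cover of the component in \<open>V\<^sup>\<bottom>\<close>, of dimension \<open>n - m\<close>,
  by about \<open>t\<^bsup>-(n - m)\<^esup>\<close> sets of diameter \<open>t\<close> cuts it into pieces of diameter at most \<open>3t\<close>, each of
  volume at most a constant times \<open>t\<^sup>n\<close>.
\<close>
lemma emeasure_slab_le:
  fixes V :: "'a::euclidean_space set" and m :: nat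
  defines "d \<equiv> DIM('a) - m"
  assumes V: "subspace V" "dim V = m" and t: "0 < t" "t \<le> 1"
  shows "emeasure lborel {y. norm y \<le> 1 \<and> norm (orth_proj V y) \<le> t}
    \<le> ennreal ((4 * (real d + 1) + 3) ^ d * 3 ^ DIM('a) * unit_ball_vol (DIM('a)) * t ^ m)"
proof -
  define S where "S = {y. norm y \<le> 1 \<and> norm (orth_proj V y) \<le> t}"
  define W where "W = {y. \<forall>x\<in>V. orthogonal x y}"
  \<comment> \<open>The grid controls differences of \<open>Q\<close>, the slab those of the projection to \<open>V\<close>.\<close>
  define Q where "Q y = y - orth_proj V y" for y
  have subW: "subspace W" unfolding W_def by (rule subspace_orthogonal_to_vectors)
  have dims: "dim W + m = DIM('a)"
    using dim_subspace_orthogonal_to_vectors[of V UNIV] V unfolding W_def by simp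
  then have dW: "dim W = d" unfolding d_def by simp
  have "Q ` S \<subseteq> W"
    unfolding W_def Q_def using orth_proj(2)[OF V(1)] by (auto simp: orthogonal_commute)
  moreover have "norm u \<le> 2" if "u \<in> Q ` S" for u
  proof -
    from that obtain y where "y \<in> S" "u = Q y" by blast
    then show ?thesis using norm_triangle_ineq4[of y "orth_proj V y"] t
      unfolding Q_def S_def by auto
  qed
  ultimately obtain \<C> where C: "finite \<C>" "Q ` S \<subseteq> \<Union>\<C>"
      "\<And>U. U \<in> \<C> \<Longrightarrow> U \<subseteq> Q ` S \<and> bounded U \<and> diameter U \<le> t"
      "real (card \<C>) \<le> (2 * 2 * (real (dim W) + 1) + 3) ^ dim W * t powr - real (dim W)"
    using grid_cover_subspace[OF subW, of "Q ` S" 2 t] t by (metis zero_le_numeral)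
  have "\<exists>p. S \<inter> Q -` U \<subseteq> cball p (3 * t)" if U: "U \<in> \<C>" for U
  proof (cases "S \<inter> Q -` U = {}")
    case False
    then obtain p where p: "p \<in> S" "Q p \<in> U" by blast
    have "dist p y \<le> 3 * t" if y: "y \<in> S" "Q y \<in> U" for y
    proof -
      have "dist (Q p) (Q y) \<le> t"
        using diameter_bounded_bound[of U "Q p" "Q y"] C(3)[OF U] p(2) y(2) by linarith
      moreover have "p - y = (Q p - Q y) + (orth_proj V p - orth_proj V y)" unfolding Q_def by simp
      then have "norm (p - y) \<le> norm (Q p - Q y) + norm (orth_proj V p - orth_proj V y)"
        by (simp only: norm_triangle_ineq)
      moreover have "norm (orth_proj V p - orth_proj V y) \<le> t + t"
        using norm_triangle_ineq4[of "orth_proj V p" "orth_proj V y"] p(1) y(1) unfolding S_def by auto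
      ultimately show ?thesis by (simp add: dist_norm)
    qed
    then show ?thesis by (intro exI[of _ p]) auto
  qed auto
  then obtain p where p: "\<And>U. U \<in> \<C> \<Longrightarrow> S \<inter> Q -` U \<subseteq> cball (p U) (3 * t)" by metis
  have "S \<subseteq> (\<Union>U\<in>\<C>. cball (p U) (3 * t))"
  proof
    fix y assume y: "y \<in> S"
    then obtain U where "U \<in> \<C>" "Q y \<in> U" using C(2) by blast
    then show "y \<in> (\<Union>U\<in>\<C>. cball (p U) (3 * t))" using p[of U] y by blast
  qed
  then have "emeasure lborel S \<le> emeasure lborel (\<Union>U\<in>\<C>. cball (p U) (3 * t))"
    by (rule emeasure_mono) (use C(1) in auto)
  also have "\<dots> \<le> (\<Sum>U\<in>\<C>. emeasure lborel (cball (p U) (3 * t)))"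
    by (rule emeasure_subadditive_finite[OF C(1)]) auto
  also have "\<dots> = (\<Sum>U\<in>\<C>. ennreal (unit_ball_vol (DIM('a)) * (3 * t) ^ DIM('a)))"
    using t by (intro sum.cong refl emeasure_cball) simp
  also have "\<dots> = ennreal (real (card \<C>) * (unit_ball_vol (DIM('a)) * (3 * t) ^ DIM('a)))"
    using t by (simp add: ennreal_mult'' ennreal_of_nat_eq_real_of_nat)
  also have "\<dots> \<le> ennreal ((4 * (real d + 1) + 3) ^ d * t powr - real d *
      (unit_ball_vol (DIM('a)) * (3 * t) ^ DIM('a)))"
    using C(4) t unfolding dW by (intro ennreal_leI mult_right_mono) auto
  also have "(4 * (real d + 1) + 3) ^ d * t powr - real d * (unit_ball_vol (DIM('a)) * (3 * t) ^ DIM('a))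
      = (4 * (real d + 1) + 3) ^ d * 3 ^ DIM('a) * unit_ball_vol (DIM('a)) * t ^ m"
  proof -
    have "t powr - real d * t ^ DIM('a) = t ^ m"
    proof -
      have "t powr - real d * t ^ DIM('a) = t powr (- real d + real (DIM('a)))"
        using t by (simp only: powr_add powr_realpow)
      also have "- real d + real (DIM('a)) = real m" using dims dW by linarith
      finally show ?thesis using t by (simp add: powr_realpow)
    qed
    then show ?thesis by (simp add: power_mult_distrib mult_ac)
  qed
  finally show ?thesis unfolding S_def .
qed

lemma grassmannian_haarD:
  fixes M :: "(real ^ 'n) set measure"
  assumes "grassmannian_haar m M"
  shows "prob_space M" "sets M = sets (grassmannian_borel m)" "space M = grassmannian m"
    "\<And>f. orthogonal_transformation f \<Longrightarrow> distr M M (\<lambda>V. f ` V) = M"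
proof -
  show "prob_space M" using assms unfolding grassmannian_haar_def by auto
  show "distr M M (\<lambda>V. f ` V) = M" if "orthogonal_transformation f" for f :: "real ^ 'n \<Rightarrow> real ^ 'n"
    using assms that unfolding grassmannian_haar_def by auto
  show s: "sets M = sets (grassmannian_borel m)"
    using assms unfolding grassmannian_haar_def by auto
  show "space M = grassmannian m"
    using sets_eq_imp_space_eq[OF s] unfolding grassmannian_borel_def by simp
qed

lemma measurable_matrix_orth_proj:
  fixes M :: "(real ^ 'n) set measure"
  assumes "grassmannian_haar m M"
  shows "(\<lambda>V. matrix (orth_proj V)) \<in> borel_measurable M"
proof -
  have "(\<lambda>V. matrix (orth_proj V)) \<in> borel_measurable (grassmannian_borel m :: (real ^ 'n) set measure)"
    unfolding grassmannian_borel_def by (rule measurable_vimage_algebra1) simp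
  then show ?thesis
    by (simp only: measurable_cong_sets[OF grassmannian_haarD(2)[OF assms] refl])
qed

lemma measurable_orth_proj_pair:
  fixes M :: "(real ^ 'n) set measure"
  assumes M: "grassmannian_haar m M" and f: "f \<in> borel_measurable N" and g: "g \<in> measurable N M"
  shows "(\<lambda>x. orth_proj (g x) (f x)) \<in> borel_measurable N"
proof -
  have "(\<lambda>x. matrix (orth_proj (g x)) *v f x) \<in> borel_measurable N"
  proof (rule borel_measurable_continuous_Pair[where H = "(*v)"])
    show "(\<lambda>x. matrix (orth_proj (g x))) \<in> borel_measurable N"
      using measurable_compose[OF g measurable_matrix_orth_proj[OF M]] .
    show "continuous_on UNIV (\<lambda>p::(real^'n^'n) \<times> (real^'n). fst p *v snd p)"
      unfolding matrix_vector_mult_def by (intro continuous_intros)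
  qed (rule f)
  moreover have "matrix (orth_proj (g x)) *v f x = orth_proj (g x) (f x)" if "x \<in> space N" for x
  proof -
    have "g x \<in> grassmannian m"
      using measurable_space[OF g that] grassmannian_haarD(3)[OF M] by simp
    then have "linear (orth_proj (g x))" unfolding grassmannian_def by (auto intro: linear_orth_proj)
    then show ?thesis by (simp add: matrix_works)
  qed
  ultimately show ?thesis by (simp cong: measurable_cong)
qed

text \<open>
  In matrix coordinates, rotating the plane is the conjugation \<open>A \<mapsto> F A F\<^sup>-\<^sup>1\<close>, which is continuous.
\<close>
lemma measurable_orthogonal_image_grassmannian:
  fixes M :: "(real ^ 'n) set measure"
  assumes M: "grassmannian_haar m M" and f: "orthogonal_transformation f"
  shows "(\<lambda>V. f ` V) \<in> measurable M M"
proof -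
  have lin: "linear f" using f by (rule orthogonal_transformation_linear)
  have inj: "inj f" using f by (rule orthogonal_transformation_inj)
  have surj: "surj f" using f by (rule orthogonal_transformation_surj)
  have linv: "linear (inv f)"
    using orthogonal_transformation_inv[OF f] by (rule orthogonal_transformation_linear)
  have "(\<lambda>V. f ` V) \<in> measurable M (grassmannian_borel m)"
    unfolding grassmannian_borel_def
  proof (rule measurable_vimage_algebra2)
    show "(`) f \<in> space M \<rightarrow> grassmannian m"
      unfolding grassmannian_haarD(3)[OF M] grassmannian_def
      using linear_subspace_image[OF lin] dim_image_eq[OF lin] inj by (auto simp: inj_on_def)
    have cont: "continuous_on UNIV (\<lambda>A::real^'n^'n. matrix f ** (A ** matrix (inv f)))"
      unfolding matrix_matrix_mult_def by (intro continuous_intros)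
    have "(\<lambda>V. matrix f ** (matrix (orth_proj V) ** matrix (inv f))) \<in> borel_measurable M"
      by (rule measurable_compose[OF measurable_matrix_orth_proj[OF M] borel_measurable_continuous_onI[OF cont]])
    moreover have "matrix f ** (matrix (orth_proj V) ** matrix (inv f)) = matrix (orth_proj (f ` V))"
      if "V \<in> space M" for V
    proof -
      have V: "subspace V" using that unfolding grassmannian_haarD(3)[OF M] grassmannian_def by simp
      have "orth_proj (f ` V) = f \<circ> (orth_proj V \<circ> inv f)"
      proof
        fix x
        have "x = f (inv f x)" using surj by (simp add: surj_f_inv_f)
        then show "orth_proj (f ` V) x = (f \<circ> (orth_proj V \<circ> inv f)) x"
          using orth_proj_orthogonal_image[OF V f, of "inv f x"] by simp
      qed
      then show ?thesis
        using lin linv linear_orth_proj[OF V]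
        by (simp add: matrix_compose linear_compose)
    qed
    ultimately show "(\<lambda>V. matrix (orth_proj (f ` V))) \<in> borel_measurable M"
      by (simp cong: measurable_cong)
  qed
  then show ?thesis
    by (simp only: measurable_cong_sets[OF refl grassmannian_haarD(2)[OF M]])
qed

text \<open>
  The orthogonal group acts transitively on spheres, and \<open>|P\<^bsub>f V\<^esub> (f x)| = |P\<^sub>V x|\<close>.
\<close>
lemma emeasure_small_projection_rotate:
  fixes M :: "(real ^ 'n) set measure"
  assumes M: "grassmannian_haar m M" and "norm x = norm y"
  shows "emeasure M {V\<in>space M. norm (orth_proj V x) \<le> t}
    = emeasure M {V\<in>space M. norm (orth_proj V y) \<le> t}"
proof -
  obtain f :: "real ^ 'n \<Rightarrow> real ^ 'n" where f: "orthogonal_transformation f" "f x = y"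
    using orthogonal_transformation_exists[OF assms(2)] by blast
  have meas: "{V\<in>space M. norm (orth_proj V y) \<le> t} \<in> sets M"
    using measurable_orth_proj_pair[OF M, of "\<lambda>_. y" M "\<lambda>V. V"] by simp
  have eq: "(\<lambda>V. f ` V) -` {V\<in>space M. norm (orth_proj V y) \<le> t} \<inter> space M
      = {V\<in>space M. norm (orth_proj V x) \<le> t}"
  proof -
    have "norm (orth_proj (f ` V) y) = norm (orth_proj V x)" if "V \<in> space M" for V
    proof -
      have V: "subspace V" using that unfolding grassmannian_haarD(3)[OF M] grassmannian_def by simp
      show ?thesis using orth_proj_orthogonal_image[OF V f(1), of x] f orthogonal_transformation_norm
        by metis
    qed
    moreover have "f ` V \<in> space M" if "V \<in> space M" for V
      using measurable_space[OF measurable_orthogonal_image_grassmannian[OF M f(1)] that] .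
    ultimately show ?thesis by auto
  qed
  have "emeasure M {V\<in>space M. norm (orth_proj V y) \<le> t}
      = emeasure (distr M M (\<lambda>V. f ` V)) {V\<in>space M. norm (orth_proj V y) \<le> t}"
    using grassmannian_haarD(4)[OF M f(1)] by simp
  also have "\<dots> = emeasure M ((\<lambda>V. f ` V) -` {V\<in>space M. norm (orth_proj V y) \<le> t} \<inter> space M)"
    by (rule emeasure_distr[OF measurable_orthogonal_image_grassmannian[OF M f(1)] meas])
  finally show ?thesis unfolding eq by simp
qed

text \<open>
  By rotation invariance the probability \<open>p\<close> of \<open>|P\<^sub>V e| \<le> t\<close> is the same for all unit vectors \<open>e\<close>, and the probability
  of \<open>|P\<^sub>V y| \<le> t\<close> is at least \<open>p\<close> for all \<open>y\<close> in the unit ball. Averaging over the ball and exchanging the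
  integrals bounds \<open>p\<close> times the volume of the ball by the volume of a slab, for a fixed plane.
\<close>
lemma measure_small_projection_le:
  fixes M :: "(real ^ 'n) set measure"
  assumes M: "grassmannian_haar m M"
  obtains C where "1 \<le> C"
    "\<And>z t. z \<noteq> 0 \<Longrightarrow> 0 < t \<Longrightarrow> measure M {V\<in>space M. norm (orth_proj V z) \<le> t} \<le> C * (t / norm z) ^ m"
proof -
  interpret prob_space M by (rule grassmannian_haarD(1)[OF M])
  interpret P: pair_sigma_finite "lborel :: (real^'n) measure" M
    by (simp add: pair_sigma_finite_def lborel.sigma_finite_measure_axioms sigma_finite_measure_axioms)
  define d where "d = CARD('n) - m"
  define v where "v = unit_ball_vol (real CARD('n))"
  have v: "v > 0" unfolding v_def by simp
  define K where "K = (4 * (real d + 1) + 3) ^ d * 3 ^ CARD('n)"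
  have K: "K \<ge> 1" unfolding K_def by (intro mult_ge1_I one_le_power) auto
  have unit: "measure M {V\<in>space M. norm (orth_proj V e) \<le> t} \<le> K * t ^ m"
    if e: "norm e = 1" and t: "0 < t" "t \<le> 1" for e t
  proof -
    define p where "p = measure M {V\<in>space M. norm (orth_proj V e) \<le> t}"
    have pe: "emeasure M {V\<in>space M. norm (orth_proj V e) \<le> t} = ennreal p"
      unfolding p_def by (rule emeasure_eq_measure)
    define S where "S = {z\<in>space (lborel \<Otimes>\<^sub>M M). norm (fst z) \<le> 1 \<and> norm (orth_proj (snd z) (fst z)) \<le> t}"
    have meas: "(\<lambda>z. orth_proj (snd z) (fst z)) \<in> borel_measurable (lborel \<Otimes>\<^sub>M M)"
      by (rule measurable_orth_proj_pair[OF M]) auto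
    have S: "S \<in> sets (lborel \<Otimes>\<^sub>M M)" unfolding S_def using meas by measurable
    have slice1: "Pair y -` S = {V\<in>space M. norm (orth_proj V y) \<le> t}" if "norm y \<le> 1" for y
      using that unfolding S_def by (auto simp: space_pair_measure)
    have slice2: "(\<lambda>y. (y, V)) -` S = {y. norm y \<le> 1 \<and> norm (orth_proj V y) \<le> t}" if "V \<in> space M" for V
      using that unfolding S_def by (auto simp: space_pair_measure)
    have low: "ennreal p \<le> emeasure M (Pair y -` S)" if y: "norm y \<le> 1" for y
    proof -
      \<comment> \<open>At the origin any unit vector serves, as its projection is at least as long.\<close>
      define u where "u = (if y = 0 then e else y /\<^sub>R norm y)"
      have u: "norm u = 1" "y = norm y *\<^sub>R u" unfolding u_def using e by auto
      have "ennreal p = emeasure M {V\<in>space M. norm (orth_proj V u) \<le> t}"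
        unfolding pe[symmetric] by (rule emeasure_small_projection_rotate[OF M]) (simp add: e u)
      also have "\<dots> \<le> emeasure M {V\<in>space M. norm (orth_proj V y) \<le> t}"
      proof (rule emeasure_mono)
        show "{V\<in>space M. norm (orth_proj V y) \<le> t} \<in> sets M"
          using measurable_orth_proj_pair[OF M, of "\<lambda>_. y" M "\<lambda>V. V"] by simp
        show "{V \<in> space M. norm (orth_proj V u) \<le> t} \<subseteq> {V \<in> space M. norm (orth_proj V y) \<le> t}"
        proof clarify
          fix V assume V: "V \<in> space M" "norm (orth_proj V u) \<le> t"
          then have "subspace V" unfolding grassmannian_haarD(3)[OF M] grassmannian_def by simp
          then have "orth_proj V y = norm y *\<^sub>R orth_proj V u"
            using u(2) linear_cmul[OF linear_orth_proj] by metis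
          then have "norm (orth_proj V y) = norm y * norm (orth_proj V u)" by simp
          also have "\<dots> \<le> 1 * t" using V(2) y t by (intro mult_mono) auto
          finally show "norm (orth_proj V y) \<le> t" by simp
        qed
      qed
      finally show ?thesis using slice1[OF y] by simp
    qed
    have "ennreal p * ennreal v = (\<integral>\<^sup>+y. ennreal p * indicator (cball 0 1) y \<partial>(lborel :: (real^'n) measure))"
      unfolding v_def by (simp add: nn_integral_cmult_indicator emeasure_cball)
    also have "\<dots> \<le> (\<integral>\<^sup>+y. emeasure M (Pair y -` S) \<partial>lborel)"
      by (intro nn_integral_mono) (auto simp: low split: split_indicator)
    also have "\<dots> = emeasure (lborel \<Otimes>\<^sub>M M) S"
      by (rule emeasure_pair_measure_alt[OF S, symmetric])
    also have "\<dots> = (\<integral>\<^sup>+V. emeasure lborel ((\<lambda>y. (y, V)) -` S) \<partial>M)"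
      by (rule P.emeasure_pair_measure_alt2[OF S])
    also have "\<dots> \<le> (\<integral>\<^sup>+V. ennreal (K * v * t ^ m) \<partial>M)"
    proof (rule nn_integral_mono)
      fix V assume V: "V \<in> space M"
      then have V': "subspace V" "dim V = m" unfolding grassmannian_haarD(3)[OF M] grassmannian_def by auto
      have "emeasure lborel {y. norm y \<le> 1 \<and> norm (orth_proj V y) \<le> t}
          \<le> ennreal ((4 * (real (DIM(real^'n) - m) + 1) + 3) ^ (DIM(real^'n) - m) * 3 ^ DIM(real^'n)
            * unit_ball_vol (DIM(real^'n)) * t ^ m)"
        unfolding slice2[OF V] by (rule emeasure_slab_le[OF V' t])
      then show "emeasure lborel ((\<lambda>y. (y, V)) -` S) \<le> ennreal (K * v * t ^ m)"
        unfolding slice2[OF V] K_def d_def v_def by simp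
    qed
    also have "\<dots> = ennreal (K * v * t ^ m)" by (simp add: emeasure_space_1)
    finally have "ennreal (p * v) \<le> ennreal (K * v * t ^ m)"
      using v by (simp add: ennreal_mult'')
    then have "p * v \<le> (K * t ^ m) * v" using K v t by (simp add: mult_ac)
    then show ?thesis using v unfolding p_def by simp
  qed
  show ?thesis
  proof (rule that[OF K])
    fix z :: "real^'n" and t :: real assume z: "z \<noteq> 0" and t: "0 < t"
    define e where "e = z /\<^sub>R norm z"
    have e: "norm e = 1" "z = norm z *\<^sub>R e" unfolding e_def using z by auto
    show "measure M {V\<in>space M. norm (orth_proj V z) \<le> t} \<le> K * (t / norm z) ^ m"
    proof (cases "t / norm z \<le> 1")
      case True
      have "norm (orth_proj V z) = norm z * norm (orth_proj V e)" if "V \<in> space M" for V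
      proof -
        from that have "subspace V" unfolding grassmannian_haarD(3)[OF M] grassmannian_def by simp
        then have "orth_proj V z = norm z *\<^sub>R orth_proj V e"
          using e(2) linear_cmul[OF linear_orth_proj] by metis
        then show ?thesis by simp
      qed
      then have "{V\<in>space M. norm (orth_proj V z) \<le> t} = {V\<in>space M. norm (orth_proj V e) \<le> t / norm z}"
        using z by (auto simp: field_simps)
      then show ?thesis using unit[OF e(1) _ True] z t by simp
    next
      case False
      then have "1 \<le> K * (t / norm z) ^ m"
        using K by (intro mult_ge1_I one_le_power) auto
      then show ?thesis using prob_le_1 by (rule order_trans[rotated])
    qed
  qed
qed

section \<open>Covering numbers of almost every projection\<close>

lemma dyadic_scale_exists:
  assumes "1 \<le> (x::real)"
  obtains J :: nat where "2 ^ J \<le> x" "x < 2 ^ Suc J"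
proof -
  define J where "J = nat \<lfloor>log 2 x\<rfloor>"
  have "0 \<le> log 2 x" using assms by simp
  then have J: "real J \<le> log 2 x" "log 2 x < real (Suc J)" unfolding J_def by linarith+
  have "2 powr real J \<le> x" using J(1) assms by (simp add: powr_le_iff)
  moreover have "x < 2 powr real (Suc J)" using J(2) assms by (simp only: less_powr_iff)
  ultimately show ?thesis by (intro that[of J]) (simp_all only: powr_realpow zero_less_numeral)
qed

lemma bounded_orth_proj_image:
  assumes "subspace V" "bounded E"
  shows "bounded (orth_proj V ` E)"
  using bounded_linear_image[OF assms(2)] linear_orth_proj[OF assms(1)]
  by (simp add: linear_conv_bounded_linear)

text \<open>
  The function \<open>u\<close> is the normalised energy of the Frostman weights under projection to \<open>V\<close>. The constant \<open>A\<close> does not depend on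
  \<open>\<delta>\<close>, since the total weight is bounded below by a number that depends only on \<open>\<epsilon>\<close> and \<open>s\<close>.
\<close>
lemma expected_energy_le:
  fixes E :: "(real ^ 'n) set"
  assumes E: "bounded E" and M: "grassmannian_haar m M"
    and s: "0 \<le> s" "s < real m" and \<theta>: "0 < \<theta>" "\<theta> \<le> 1" "s \<le> (1 - \<theta>) * real m" and \<epsilon>: "0 < \<epsilon>"
  obtains A where
    "\<And>\<delta>. 0 < \<delta> \<Longrightarrow> \<delta> \<le> 1 \<Longrightarrow> (\<And>\<C>. \<not> intermediate_cover E \<theta> s \<delta> \<epsilon> \<C>) \<Longrightarrow>
      \<exists>u. integrable M u \<and> (\<forall>V. 0 \<le> u V) \<and> integral\<^sup>L M u \<le> A * (\<delta> powr (1 / \<theta>)) powr s \<and>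
        (\<forall>V\<in>space M. 1 \<le> real (covering_number (orth_proj V ` E) (\<delta> powr (1 / \<theta>))) * u V)"
proof -
  interpret prob_space M by (rule grassmannian_haarD(1)[OF M])
  obtain C where C: "1 \<le> C" "\<And>z t. z \<noteq> 0 \<Longrightarrow> 0 < t \<Longrightarrow>
      measure M {V\<in>space M. norm (orth_proj V z) \<le> t} \<le> C * (t / norm z) ^ m"
    by (rule measure_small_projection_le[OF M], rule that) simp_all
  \<comment> \<open>The factor \<open>12\<^sup>m\<close> converts the scale \<open>\<rho>\<close> of the covers to the radius \<open>\<rho> / 12\<close> of the weights.\<close>
  define C' where "C' = C * 12 ^ m"
  have C': "1 \<le> C'" unfolding C'_def using C(1) by (intro mult_ge1_I one_le_power) auto
  define G where "G = 1 / (1 - 2 powr (s - real m))"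
  have "2 powr (s - real m) < (2::real) powr 0" using s(2) by (intro powr_less_mono) auto
  then have G: "0 < G" unfolding G_def by simp
  define c where "c = \<epsilon> / 12 powr s"
  have c: "0 < c" unfolding c_def using \<epsilon> by simp
  define A where "A = C' * 2 ^ m * (G / c + 1)"
  show ?thesis
  proof (rule that[of A])
    fix \<delta> :: real
    assume \<delta>: "0 < \<delta>" "\<delta> \<le> 1" and no_cover: "\<And>\<C>. \<not> intermediate_cover E \<theta> s \<delta> \<epsilon> \<C>"
    define \<rho> where "\<rho> = \<delta> powr (1 / \<theta>)"
    have \<rho>: "0 < \<rho>" unfolding \<rho>_def using \<delta> by simp
    have "\<rho> \<le> \<delta> powr 1" unfolding \<rho>_def using \<delta> \<theta> by (intro powr_mono') auto
    then have "1 \<le> \<delta> / \<rho>" using \<rho> \<delta> by simp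
    then obtain J where J: "2 ^ J \<le> \<delta> / \<rho>" "\<delta> / \<rho> < 2 ^ Suc J" by (rule dyadic_scale_exists)
    \<comment> \<open>Balls of radius \<open>6 r\<close> then have diameter exactly \<open>\<rho>\<close>, the smallest admissible one.\<close>
    define r where "r = \<rho> / 12"
    have r: "0 < r" unfolding r_def using \<rho> by simp
    have sc: "\<delta> powr (1 / \<theta>) \<le> 12 * r" "12 * r * 2 ^ J \<le> \<delta>"
      unfolding r_def using J(1) \<rho> by (auto simp: \<rho>_def[symmetric] field_simps)
    obtain X w where X: "finite X" "X \<subseteq> E" and w: "\<And>x. 0 \<le> w x"
      and mass: "\<And>x j. x \<in> X \<Longrightarrow> j \<le> J \<Longrightarrow> sum w (X \<inter> cball x (r * 2 ^ j)) \<le> (r * 2 ^ j) powr s"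
      and big: "c < sum w X"
      by (rule frostman_weights_exist[OF E s(1) r sc no_cover], rule that) (simp_all add: c_def)
    define W where "W = sum w X"
    have W: "c < W" "0 < W" using big c unfolding W_def by auto
    define B where "B x y = {V\<in>space M. norm (orth_proj V (x - y)) \<le> \<rho>}" for x y
    define p where "p x y = measure M (B x y)" for x y
    have B: "B x y \<in> sets M" for x y
      unfolding B_def using measurable_orth_proj_pair[OF M, of "\<lambda>_. x - y" M "\<lambda>V. V"] by simp
    have ind: "integrable M (\<lambda>V. w x * w y * indicator (B x y) V :: real)" for x y
      by (intro integrable_mult_right integrable_real_indicator B) (simp add: emeasure_eq_measure)
    define u where "u V = (\<Sum>x\<in>X. \<Sum>y\<in>X. w x * w y * indicator (B x y) V) / W\<^sup>2" for V
    have int: "integrable M u"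
      unfolding u_def by (intro integrable_divide Bochner_Integration.integrable_sum ind)
    have nonneg: "0 \<le> u V" for V
      unfolding u_def by (intro divide_nonneg_nonneg sum_nonneg mult_nonneg_nonneg w) auto
    have lower: "1 \<le> real (covering_number (orth_proj V ` E) \<rho>) * u V" if V: "V \<in> space M" for V
    proof -
      have sub: "subspace V" using V unfolding grassmannian_haarD(3)[OF M] grassmannian_def by simp
      have bdd: "bounded (orth_proj V ` E)"
        by (rule bounded_orth_proj_image[OF sub E])
      have "sum w {y\<in>X. dist (orth_proj V x) (orth_proj V y) \<le> \<rho>} = (\<Sum>y\<in>X. w y * indicator (B x y) V)" for x
      proof -
        have "{y\<in>X. dist (orth_proj V x) (orth_proj V y) \<le> \<rho>} = {y\<in>X. V \<in> B x y}"
          unfolding B_def using V by (simp add: dist_norm orth_proj_diff[OF sub])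
        moreover have "(\<Sum>y\<in>X. w y * indicator (B x y) V) = (\<Sum>y\<in>X. if V \<in> B x y then w y else 0)"
          by (intro sum.cong) auto
        ultimately show ?thesis by (simp only: sum.inter_filter[OF X(1)])
      qed
      then have "(\<Sum>x\<in>X. w x * sum w {y\<in>X. dist (orth_proj V x) (orth_proj V y) \<le> \<rho>}) = u V * W\<^sup>2"
        using W unfolding u_def by (simp add: sum_distrib_left mult.assoc)
      then have "W\<^sup>2 \<le> real (covering_number (orth_proj V ` E) \<rho>) * (u V * W\<^sup>2)"
        using weight_square_le_covering_number_times_energy[where w = w, OF X w bdd \<rho>]
        unfolding W_def by simp
      then have "1 * W\<^sup>2 \<le> (real (covering_number (orth_proj V ` E) \<rho>) * u V) * W\<^sup>2"
        by (simp only: mult_1 mult.assoc)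
      then show ?thesis using W(2) by (simp only: mult_le_cancel_right zero_less_power)
    qed
    \<comment> \<open>The only place where \<open>s \<le> (1 - \<theta>) m\<close> enters: pairs at distance above \<open>\<delta>\<close>.\<close>
    have decay: "(1 / 2 ^ J) ^ m \<le> 2 ^ m * \<rho> powr s"
    proof -
      have "1 / 2 ^ J \<le> 2 * (\<rho> / \<delta>)" using J(2) \<rho> \<delta> by (simp add: field_simps)
      then have "(1 / 2 ^ J) ^ m \<le> (2 * (\<rho> / \<delta>)) ^ m" by (intro power_mono) auto
      also have "\<dots> = 2 ^ m * (\<rho> / \<delta>) ^ m" by (rule power_mult_distrib)
      also have "(\<rho> / \<delta>) ^ m = \<delta> powr ((1 / \<theta> - 1) * real m)"
      proof -
        have "\<rho> / \<delta> = \<delta> powr (1 / \<theta> - 1)" unfolding \<rho>_def using \<delta> by (simp add: powr_diff)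
        then show ?thesis using \<delta> by (simp add: powr_power mult.commute)
      qed
      also have "2 ^ m * \<delta> powr ((1 / \<theta> - 1) * real m) \<le> 2 ^ m * \<delta> powr (1 / \<theta> * s)"
      proof (intro mult_left_mono powr_mono')
        have "s / \<theta> \<le> (1 - \<theta>) * real m / \<theta>" using \<theta> by (intro divide_right_mono) auto
        also have "\<dots> = (1 / \<theta> - 1) * real m" using \<theta> by (simp add: field_simps)
        finally show "1 / \<theta> * s \<le> (1 / \<theta> - 1) * real m" by simp
      qed (use \<delta> in auto)
      finally show ?thesis unfolding \<rho>_def by (simp add: powr_powr)
    qed
    have potential: "(\<Sum>y\<in>X. w y * p x y) \<le> C' * 2 ^ m * \<rho> powr s * (G + W)" if x: "x \<in> X" for x
    proof -
      have "(\<Sum>y\<in>X. w y * p x y)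
          \<le> C' * (2 ^ m / (1 - 2 powr (s - real m)) * r powr s + (1 / 2 ^ J) ^ m * sum w X)"
      proof (rule dyadic_potential_le[where d = "dist x"])
        show "p x y \<le> 1" for y unfolding p_def by simp
        show "p x y \<le> C' * (r / dist x y) ^ m" if "0 < dist x y" for y
        proof -
          have "p x y \<le> C * (\<rho> / norm (x - y)) ^ m"
            unfolding p_def B_def using that \<rho> by (intro C(2)) auto
          also have "\<rho> / norm (x - y) = 12 * (r / dist x y)" unfolding r_def by (simp add: dist_norm)
          finally show ?thesis unfolding C'_def by (simp only: power_mult_distrib mult.assoc)
        qed
        show "sum w {y \<in> X. dist x y \<le> r * 2 ^ j} \<le> (r * 2 ^ j) powr s" if "j \<le> J" for j
        proof -
          have "{y \<in> X. dist x y \<le> r * 2 ^ j} = X \<inter> cball x (r * 2 ^ j)" by auto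
          then show ?thesis using mass[OF x that] by simp
        qed
      qed (use X(1) w r s C' in auto)
      also have "\<dots> \<le> C' * (2 ^ m * G * \<rho> powr s + (2 ^ m * \<rho> powr s) * W)"
      proof (intro mult_left_mono add_mono mult_mono)
        show "2 ^ m / (1 - 2 powr (s - real m)) \<le> 2 ^ m * G" unfolding G_def by simp
        show "r powr s \<le> \<rho> powr s" using s(1) \<rho> unfolding r_def by (intro powr_mono2) auto
        show "sum w X \<le> W" unfolding W_def ..
      qed (use decay G C' W w in \<open>auto intro: sum_nonneg\<close>)
      also have "\<dots> = C' * 2 ^ m * \<rho> powr s * (G + W)" by (simp add: algebra_simps)
      finally show ?thesis .
    qed
    have "integral\<^sup>L M u = (\<Sum>x\<in>X. \<Sum>y\<in>X. w x * w y * p x y) / W\<^sup>2"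
    proof -
      have val: "integral\<^sup>L M (\<lambda>V. w x * w y * indicator (B x y) V) = w x * w y * p x y" for x y
        unfolding p_def using B[of x y] by simp
      have inner: "integral\<^sup>L M (\<lambda>V. \<Sum>y\<in>X. w x * w y * indicator (B x y) V)
          = (\<Sum>y\<in>X. w x * w y * p x y)" for x
        unfolding val[symmetric] by (rule Bochner_Integration.integral_sum) (rule ind)
      have "integral\<^sup>L M (\<lambda>V. \<Sum>x\<in>X. \<Sum>y\<in>X. w x * w y * indicator (B x y) V)
          = (\<Sum>x\<in>X. \<Sum>y\<in>X. w x * w y * p x y)"
        unfolding inner[symmetric]
        by (rule Bochner_Integration.integral_sum) (intro Bochner_Integration.integrable_sum ind)
      then show ?thesis unfolding u_def by simp
    qed
    also have "(\<Sum>x\<in>X. \<Sum>y\<in>X. w x * w y * p x y) = (\<Sum>x\<in>X. w x * (\<Sum>y\<in>X. w y * p x y))"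
      by (simp only: sum_distrib_left mult.assoc)
    also have "(\<Sum>x\<in>X. w x * (\<Sum>y\<in>X. w y * p x y)) / W\<^sup>2
        \<le> (\<Sum>x\<in>X. w x * (C' * 2 ^ m * \<rho> powr s * (G + W))) / W\<^sup>2"
      by (intro divide_right_mono sum_mono mult_left_mono potential w) auto
    also have "\<dots> = C' * 2 ^ m * (G / W + 1) * \<rho> powr s"
      unfolding sum_distrib_right[symmetric] W_def[symmetric]
      using W(2) by (simp add: power2_eq_square field_simps)
    also have "\<dots> \<le> A * \<rho> powr s"
      unfolding A_def using W c G C' by (intro mult_right_mono mult_left_mono add_right_mono divide_left_mono) auto
    finally have "integral\<^sup>L M u \<le> A * \<rho> powr s" .
    with int nonneg lower show "\<exists>u. integrable M u \<and> (\<forall>V. 0 \<le> u V) \<and>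
        integral\<^sup>L M u \<le> A * (\<delta> powr (1 / \<theta>)) powr s \<and>
        (\<forall>V\<in>space M. 1 \<le> real (covering_number (orth_proj V ` E) (\<delta> powr (1 / \<theta>))) * u V)"
      unfolding \<rho>_def by blast
  qed
qed

text \<open>
  Since \<open>u\<close> has expectation at most \<open>A \<rho>\<^sup>s\<close>, it exceeds \<open>\<rho>\<^sup>t\<close> with probability at most \<open>A \<rho>\<^bsup>s - t\<^esup>\<close>, which is summable along
  exponentially decaying scales; and \<open>1 / u\<close> is a lower bound for the covering number.
\<close>
lemma AE_eventually_covering_number_ge:
  fixes E :: "(real ^ 'n) set" and \<delta> :: "nat \<Rightarrow> real"
  assumes E: "bounded E" and M: "grassmannian_haar m M"
    and s: "0 \<le> s" "s < real m" and \<theta>: "0 < \<theta>" "\<theta> \<le> 1" "s \<le> (1 - \<theta>) * real m" and \<epsilon>: "0 < \<epsilon>"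
    and \<delta>: "\<And>k. 0 < \<delta> k" "\<And>k. \<delta> k \<le> 2 powr - real k"
    and no_cover: "\<And>k \<C>. \<not> intermediate_cover E \<theta> s (\<delta> k) \<epsilon> \<C>" and t: "t < s"
  shows "AE V in M. \<forall>\<^sub>F k in sequentially. (\<delta> k powr (1 / \<theta>)) powr - t
    \<le> real (covering_number (orth_proj V ` E) (\<delta> k powr (1 / \<theta>)))"
proof -
  interpret prob_space M by (rule grassmannian_haarD(1)[OF M])
  obtain A where A: "\<And>\<delta>. 0 < \<delta> \<Longrightarrow> \<delta> \<le> 1 \<Longrightarrow> (\<And>\<C>. \<not> intermediate_cover E \<theta> s \<delta> \<epsilon> \<C>) \<Longrightarrow>
      \<exists>u. integrable M u \<and> (\<forall>V. 0 \<le> u V) \<and> integral\<^sup>L M u \<le> A * (\<delta> powr (1 / \<theta>)) powr s \<and>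
        (\<forall>V\<in>space M. 1 \<le> real (covering_number (orth_proj V ` E) (\<delta> powr (1 / \<theta>))) * u V)"
    by (rule expected_energy_le[OF E M s \<theta> \<epsilon>], rule that) blast
  define \<rho> where "\<rho> k = \<delta> k powr (1 / \<theta>)" for k
  have \<rho>: "0 < \<rho> k" for k unfolding \<rho>_def using \<delta>(1)[of k] by simp
  have le1: "\<delta> k \<le> 1" for k
  proof -
    have "2 powr - real k \<le> (2::real) powr 0" by (intro powr_mono) auto
    then show ?thesis using \<delta>(2)[of k] by simp
  qed
  have "\<forall>k. \<exists>u. integrable M u \<and> (\<forall>V. 0 \<le> u V) \<and> integral\<^sup>L M u \<le> A * \<rho> k powr s \<and>
        (\<forall>V\<in>space M. 1 \<le> real (covering_number (orth_proj V ` E) (\<rho> k)) * u V)"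
    unfolding \<rho>_def using A[OF \<delta>(1) le1 no_cover] by blast
  then obtain u where u: "\<And>k. integrable M (u k)" "\<And>k V. 0 \<le> u k V"
      "\<And>k. integral\<^sup>L M (u k) \<le> A * \<rho> k powr s"
      "\<And>k V. V \<in> space M \<Longrightarrow> 1 \<le> real (covering_number (orth_proj V ` E) (\<rho> k)) * u k V"
    by metis
  define Bad where "Bad k = {V\<in>space M. \<rho> k powr t \<le> u k V}" for k
  have meas: "Bad k \<in> sets M" for k
    unfolding Bad_def using borel_measurable_integrable[OF u(1)[of k]] by measurable
  have bad: "measure M (Bad k) \<le> \<bar>A\<bar> * (2 powr (- (s - t) / \<theta>)) ^ k" for k
  proof -
    have "measure M (Bad k) \<le> integral\<^sup>L M (u k) / \<rho> k powr t"
      unfolding Bad_def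
      by (rule integral_Markov_inequality_measure[OF u(1), of "space M"]) (use u(2) \<rho>[of k] in auto)
    also have "\<dots> \<le> (\<bar>A\<bar> * \<rho> k powr s) / \<rho> k powr t"
    proof (rule divide_right_mono)
      have "A * \<rho> k powr s \<le> \<bar>A\<bar> * \<rho> k powr s" by (intro mult_right_mono) auto
      then show "integral\<^sup>L M (u k) \<le> \<bar>A\<bar> * \<rho> k powr s" using u(3)[of k] by linarith
    qed simp
    also have "\<dots> = \<bar>A\<bar> * \<rho> k powr (s - t)" using \<rho>[of k] by (simp add: powr_diff)
    also have "\<dots> \<le> \<bar>A\<bar> * (2 powr (- (s - t) / \<theta>)) ^ k"
    proof (rule mult_left_mono)
      have "\<rho> k powr (s - t) = \<delta> k powr ((s - t) / \<theta>)" unfolding \<rho>_def by (simp add: powr_powr)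
      also have "\<dots> \<le> (2 powr - real k) powr ((s - t) / \<theta>)"
        using t \<theta> \<delta>(1)[of k] \<delta>(2)[of k] by (intro powr_mono2) auto
      also have "\<dots> = 2 powr ((- (s - t) / \<theta>) * real k)"
        unfolding powr_powr by (simp only: minus_divide_left[symmetric] mult_minus_left mult_minus_right mult.commute)
      also have "\<dots> = (2 powr (- (s - t) / \<theta>)) ^ k"
        by (simp only: powr_powr[symmetric] powr_realpow powr_gt_zero)
      finally show "\<rho> k powr (s - t) \<le> (2 powr (- (s - t) / \<theta>)) ^ k" .
    qed simp
    finally show ?thesis .
  qed
  have "(2::real) powr (- (s - t) / \<theta>) < 2 powr 0"
    using t \<theta> by (intro powr_less_mono) (auto simp: divide_neg_pos)
  then have "summable (\<lambda>k. \<bar>A\<bar> * (2 powr (- (s - t) / \<theta>)) ^ k)"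
    by (intro summable_mult summable_geometric) simp
  then have "summable (\<lambda>k. measure M (Bad k))"
    by (rule summable_comparison_test') (use bad in simp)
  then have "AE V in M. \<forall>\<^sub>F k in sequentially. V \<in> space M - Bad k"
    by (intro borel_cantelli_AE1 meas) (simp_all add: emeasure_eq_measure)
  then show ?thesis
  proof (rule AE_mp, intro AE_I2 impI)
    fix V assume V: "V \<in> space M" and ev: "\<forall>\<^sub>F k in sequentially. V \<in> space M - Bad k"
    from ev show "\<forall>\<^sub>F k in sequentially. (\<delta> k powr (1 / \<theta>)) powr - t
        \<le> real (covering_number (orth_proj V ` E) (\<delta> k powr (1 / \<theta>)))"
    proof (rule eventually_mono)
      fix k assume "V \<in> space M - Bad k"
      then have small: "u k V \<le> \<rho> k powr t" unfolding Bad_def by auto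
      have "1 \<le> real (covering_number (orth_proj V ` E) (\<rho> k)) * u k V" by (rule u(4)[OF V])
      also have "\<dots> \<le> real (covering_number (orth_proj V ` E) (\<rho> k)) * \<rho> k powr t"
        using small by (intro mult_left_mono) auto
      finally have "1 / \<rho> k powr t \<le> real (covering_number (orth_proj V ` E) (\<rho> k))"
        using \<rho>[of k] by (simp add: field_simps)
      then show "(\<delta> k powr (1 / \<theta>)) powr - t
          \<le> real (covering_number (orth_proj V ` E) (\<delta> k powr (1 / \<theta>)))"
        unfolding \<rho>_def[symmetric] by (simp add: powr_minus divide_inverse)
    qed
  qed
qed

section \<open>Box dimensions of almost every projection\<close>

lemma two_powr_minus_tendsto_0: "(\<lambda>k. 2 powr - real k :: real) \<longlonglongrightarrow> 0"
proof -
  have "(\<lambda>k. (1 / 2 :: real) ^ k) \<longlonglongrightarrow> 0" by (rule LIMSEQ_power_zero) simp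
  then show ?thesis by (simp add: powr_minus powr_realpow power_one_over inverse_eq_divide)
qed

text \<open>
  The scales along which covers fail are chosen one by one below \<open>2\<^bsup>-k\<^esup>\<close>. The choice \<open>\<theta> = 1 - s / m\<close> is
  the largest with \<open>s \<le> (1 - \<theta>) m\<close>.
\<close>
lemma AE_le_upper_box_dim_projection:
  fixes E :: "(real ^ 'n) set"
  assumes E: "E \<noteq> {}" "bounded E" and M: "grassmannian_haar m M"
    and t: "0 < t" "t < real m" "ereal t < upper_quasi_Hausdorff_dim E"
  shows "AE V in M. ereal t \<le> upper_box_dim (orth_proj V ` E)"
proof -
  have "ereal t < min (ereal (real m)) (upper_quasi_Hausdorff_dim E)" using t by simp
  then obtain s where s': "ereal t < ereal s" "ereal s < min (ereal (real m)) (upper_quasi_Hausdorff_dim E)"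
    using ereal_dense2 by blast
  then have s: "t < s" "s < real m" "ereal s < upper_quasi_Hausdorff_dim E" by simp_all
  have s0: "0 \<le> s" using t s by simp
  define \<theta> where "\<theta> = 1 - s / real m"
  have \<theta>: "0 < \<theta>" "\<theta> \<le> 1" "s \<le> (1 - \<theta>) * real m"
    unfolding \<theta>_def using s s0 t by (auto simp: field_simps)
  have above: "ereal s < upper_intermediate_dim \<theta> E"
    using s(3) upper_quasi_Hausdorff_dim_le[OF \<theta>(1)] by (rule order_less_le_trans)
  obtain \<epsilon> where \<epsilon>: "0 < \<epsilon>"
      "\<And>\<delta>0. 0 < \<delta>0 \<Longrightarrow> \<exists>\<delta>. 0 < \<delta> \<and> \<delta> \<le> \<delta>0 \<and> (\<forall>\<C>. \<not> intermediate_cover E \<theta> s \<delta> \<epsilon> \<C>)"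
    by (rule no_cover_if_less_upper_dim[OF s0 above], rule that) blast+
  have "\<forall>k. \<exists>\<delta>. 0 < \<delta> \<and> \<delta> \<le> 2 powr - real k \<and> (\<forall>\<C>. \<not> intermediate_cover E \<theta> s \<delta> \<epsilon> \<C>)"
    by (intro allI \<epsilon>(2)) simp
  then obtain \<delta> where \<delta>: "\<And>k. 0 < \<delta> k" "\<And>k. \<delta> k \<le> 2 powr - real k"
      "\<And>k \<C>. \<not> intermediate_cover E \<theta> s (\<delta> k) \<epsilon> \<C>"
    by metis
  have lim\<delta>: "\<delta> \<longlonglongrightarrow> 0"
    by (rule tendsto_sandwich[OF _ _ tendsto_const two_powr_minus_tendsto_0])
       (use \<delta>(1,2) in \<open>simp_all add: less_imp_le\<close>)
  have lim: "(\<lambda>k. \<delta> k powr (1 / \<theta>)) \<longlonglongrightarrow> 0"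
    using tendsto_powr2[OF lim\<delta> tendsto_const, of "1 / \<theta>"] \<theta>(1) \<delta>(1)
    by (simp add: less_imp_le)
  have "AE V in M. \<forall>\<^sub>F k in sequentially. (\<delta> k powr (1 / \<theta>)) powr - t
      \<le> real (covering_number (orth_proj V ` E) (\<delta> k powr (1 / \<theta>)))"
    by (rule AE_eventually_covering_number_ge[OF E(2) M s0 s(2) \<theta> \<epsilon>(1) \<delta> s(1)])
  then show ?thesis
  proof (rule AE_mp, intro AE_I2 impI)
    fix V assume "\<forall>\<^sub>F k in sequentially. (\<delta> k powr (1 / \<theta>)) powr - t
      \<le> real (covering_number (orth_proj V ` E) (\<delta> k powr (1 / \<theta>)))"
    then show "ereal t \<le> upper_box_dim (orth_proj V ` E)"
      by (intro upper_box_dim_ge[OF _ lim]) (use \<delta>(1) in \<open>simp_all add: less_imp_neq[THEN not_sym]\<close>)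
  qed
qed

text \<open>
  Here covers fail at all small scales, so \<open>\<delta> = 2\<^bsup>-k\<^esup>\<close> is possible. The shift by \<open>k0\<close> only drops the
  finitely many scales that are not yet small enough.
\<close>
lemma AE_le_lower_box_dim_projection:
  fixes E :: "(real ^ 'n) set"
  assumes E: "E \<noteq> {}" "bounded E" and M: "grassmannian_haar m M"
    and t: "0 < t" "t < real m" "ereal t < lower_quasi_Hausdorff_dim E"
  shows "AE V in M. ereal t \<le> lower_box_dim (orth_proj V ` E)"
proof -
  have "ereal t < min (ereal (real m)) (lower_quasi_Hausdorff_dim E)" using t by simp
  then obtain s where s': "ereal t < ereal s" "ereal s < min (ereal (real m)) (lower_quasi_Hausdorff_dim E)"
    using ereal_dense2 by blast
  then have s: "t < s" "s < real m" "ereal s < lower_quasi_Hausdorff_dim E" by simp_all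
  have s0: "0 \<le> s" using t s by simp
  define \<theta> where "\<theta> = 1 - s / real m"
  have \<theta>: "0 < \<theta>" "\<theta> \<le> 1" "s \<le> (1 - \<theta>) * real m"
    unfolding \<theta>_def using s s0 t by (auto simp: field_simps)
  have above: "ereal s < lower_intermediate_dim \<theta> E"
    using s(3) lower_quasi_Hausdorff_dim_le[OF \<theta>(1)] by (rule order_less_le_trans)
  obtain \<epsilon> \<delta>0 where \<epsilon>: "0 < \<epsilon>" "0 < \<delta>0"
      "\<And>\<delta> \<C>. 0 < \<delta> \<Longrightarrow> \<delta> \<le> \<delta>0 \<Longrightarrow> \<not> intermediate_cover E \<theta> s \<delta> \<epsilon> \<C>"
    by (rule no_cover_if_less_lower_dim[OF s0 above], rule that) assumption+
  have "\<forall>\<^sub>F k in sequentially. 2 powr - real k < \<delta>0"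
    using two_powr_minus_tendsto_0 \<epsilon>(2) by (rule order_tendstoD)
  then obtain k0 where k0: "\<And>k. k0 \<le> k \<Longrightarrow> 2 powr - real k < \<delta>0"
    by (auto simp: eventually_sequentially)
  define \<delta> where "\<delta> k = 2 powr - real (k + k0)" for k
  have scale: "\<delta> k powr (1 / \<theta>) = 2 powr - (1 / \<theta> * real (k + k0))" for k
    unfolding \<delta>_def powr_powr by (simp only: mult_minus_left mult_minus_right mult.commute)
  have scale_powr: "(2 powr - (1 / \<theta> * real (k + k0))) powr - t = 2 powr (1 / \<theta> * real (k + k0) * t)" for k
    by (simp only: powr_powr minus_mult_minus)
  have "AE V in M. \<forall>\<^sub>F k in sequentially. (\<delta> k powr (1 / \<theta>)) powr - t
      \<le> real (covering_number (orth_proj V ` E) (\<delta> k powr (1 / \<theta>)))"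
  proof (rule AE_eventually_covering_number_ge[OF E(2) M s0 s(2) \<theta> \<epsilon>(1) _ _ _ s(1)])
    show "0 < \<delta> k" for k unfolding \<delta>_def by simp
    show "\<delta> k \<le> 2 powr - real k" for k unfolding \<delta>_def by (intro powr_mono) auto
    show "\<not> intermediate_cover E \<theta> s (\<delta> k) \<epsilon> \<C>" for k \<C>
      unfolding \<delta>_def by (intro \<epsilon>(3) less_imp_le[OF k0]) auto
  qed
  then show ?thesis
  proof (rule AE_mp, intro AE_I2 impI)
    fix V assume V: "V \<in> space M" and "\<forall>\<^sub>F k in sequentially. (\<delta> k powr (1 / \<theta>)) powr - t
      \<le> real (covering_number (orth_proj V ` E) (\<delta> k powr (1 / \<theta>)))"
    then have "\<forall>\<^sub>F k in sequentially. 2 powr (1 / \<theta> * real (k + k0) * t)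
      \<le> real (covering_number (orth_proj V ` E) (2 powr - (1 / \<theta> * real (k + k0))))"
      by (simp only: scale scale_powr)
    then have ev: "\<forall>\<^sub>F k in sequentially. 2 powr (1 / \<theta> * real k * t)
      \<le> real (covering_number (orth_proj V ` E) (2 powr - (1 / \<theta> * real k)))"
      by (rule eventually_sequentially_seg[THEN iffD1])
    have "subspace V" using V unfolding grassmannian_haarD(3)[OF M] grassmannian_def by simp
    then have "bounded (orth_proj V ` E)" by (rule bounded_orth_proj_image[OF _ E(2)])
    then show "ereal t \<le> lower_box_dim (orth_proj V ` E)"
      using E(1) \<theta>(1) t(1) ev by (intro lower_box_dim_ge[where a = "1 / \<theta>"]) auto
  qed
qed

text \<open>
  The exceptional null set of the lower bound depends on \<open>t\<close>; restricting \<open>t\<close> to rationals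
  leaves countably many of them.
\<close>
lemma AE_eq_if_AE_ge_below:
  fixes d :: "'a \<Rightarrow> ereal"
  assumes d: "\<And>x. x \<in> space M \<Longrightarrow> 0 \<le> d x" "\<And>x. x \<in> space M \<Longrightarrow> d x \<le> c"
    and ge: "\<And>t. 0 < t \<Longrightarrow> ereal t < c \<Longrightarrow> AE x in M. ereal t \<le> d x"
  shows "AE x in M. d x = c"
proof -
  have "AE x in M. 0 < real_of_rat q \<longrightarrow> ereal (real_of_rat q) < c \<longrightarrow> ereal (real_of_rat q) \<le> d x" for q
    using ge[of "real_of_rat q"]
    by (cases "0 < real_of_rat q \<and> ereal (real_of_rat q) < c") auto
  then have "AE x in M. \<forall>q. 0 < real_of_rat q \<longrightarrow> ereal (real_of_rat q) < c \<longrightarrow> ereal (real_of_rat q) \<le> d x"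
    unfolding AE_all_countable ..
  then show ?thesis
  proof (rule AE_mp, intro AE_I2 impI)
    fix x assume x: "x \<in> space M"
      and *: "\<forall>q. 0 < real_of_rat q \<longrightarrow> ereal (real_of_rat q) < c \<longrightarrow> ereal (real_of_rat q) \<le> d x"
    have "\<not> d x < c"
    proof
      assume "d x < c"
      then obtain q where q: "d x < ereal (real_of_rat q)" "ereal (real_of_rat q) < c"
        using ereal_dense3 by blast
      have "0 < ereal (real_of_rat q)" using d(1)[OF x] q(1) by (rule order_le_less_trans)
      then have "0 < real_of_rat q" by simp
      then have "ereal (real_of_rat q) \<le> d x" using * q(2) by blast
      then show False using q(1) by simp
    qed
    then show "d x = c" using d(2)[OF x] by simp
  qed
qed

theorem corollary3p8:
  fixes E :: "(real ^ 'n) set" and m :: nat and \<gamma> :: "(real ^ 'n) set measure"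
  assumes "E \<noteq> {}" and "bounded E"
    and "1 \<le> m" and "m \<le> CARD('n)"
    and "grassmannian_haar m \<gamma>"
  shows "(upper_box_dim E = upper_quasi_Hausdorff_dim E \<longrightarrow>
            (AE V in \<gamma>. upper_box_dim (orth_proj V ` E) = min (ereal (real m)) (upper_box_dim E))) \<and>
         (lower_box_dim E = lower_quasi_Hausdorff_dim E \<longrightarrow>
            (AE V in \<gamma>. lower_box_dim (orth_proj V ` E) = min (ereal (real m)) (lower_box_dim E)))"
proof -
  note E = assms(1,2) and M = assms(5)
  have proj: "upper_box_dim (orth_proj V ` E) \<le> min (ereal (real m)) (upper_box_dim E)"
    "lower_box_dim (orth_proj V ` E) \<le> min (ereal (real m)) (lower_box_dim E)"
    "0 \<le> upper_box_dim (orth_proj V ` E)" "0 \<le> lower_box_dim (orth_proj V ` E)"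
    if "V \<in> space \<gamma>" for V
  proof -
    have V: "subspace V" "dim V = m"
      using that unfolding grassmannian_haarD(3)[OF M] grassmannian_def by auto
    have bdd: "bounded (orth_proj V ` E)" by (rule bounded_orth_proj_image[OF V(1) E(2)])
    have ne: "orth_proj V ` E \<noteq> {}" using E(1) by simp
    have "norm (orth_proj V x - orth_proj V y) \<le> norm (x - y)" for x y
      using norm_orth_proj_le[OF V(1), of "x - y"] by (simp add: orth_proj_diff[OF V(1)])
    note im = box_dim_image_le[OF E(2,1) bdd this]
    have "orth_proj V ` E \<subseteq> V" using orth_proj(1)[OF V(1)] by blast
    then have m: "upper_box_dim (orth_proj V ` E) \<le> ereal (real m)"
      using upper_box_dim_subspace_le[OF V(1) _ bdd ne] V(2) by simp
    show "upper_box_dim (orth_proj V ` E) \<le> min (ereal (real m)) (upper_box_dim E)"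
      using im m by simp
    show "lower_box_dim (orth_proj V ` E) \<le> min (ereal (real m)) (lower_box_dim E)"
      using im order_trans[OF lower_box_dim_le_upper m] by simp
    show nonneg: "0 \<le> lower_box_dim (orth_proj V ` E)" by (rule lower_box_dim_nonneg[OF bdd ne])
    show "0 \<le> upper_box_dim (orth_proj V ` E)"
      using nonneg lower_box_dim_le_upper by (rule order_trans)
  qed
  show ?thesis
  proof (intro conjI impI)
    assume qH: "upper_box_dim E = upper_quasi_Hausdorff_dim E"
    show "AE V in \<gamma>. upper_box_dim (orth_proj V ` E) = min (ereal (real m)) (upper_box_dim E)"
      by (rule AE_eq_if_AE_ge_below[OF proj(3) proj(1)])
         (auto simp: qH intro: AE_le_upper_box_dim_projection[OF E M])
  next
    assume qH: "lower_box_dim E = lower_quasi_Hausdorff_dim E"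
    show "AE V in \<gamma>. lower_box_dim (orth_proj V ` E) = min (ereal (real m)) (lower_box_dim E)"
      by (rule AE_eq_if_AE_ge_below[OF proj(4) proj(2)])
         (auto simp: qH intro: AE_le_lower_box_dim_projection[OF E M])
  qed
qed

end
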